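(* Let $d\ge2$ and suppose that the family $(A_g)_{g\in E}$ satisfies Assumptions 1)–9) listed in the context. Put $H=2(A+M)$, with $M$ and $A$ the constants of Assumptions 5) and 8) respectively. Let $a,b>0$ with $b\ge 2(H-1)a$, let $$T_1=[-a,a]^d,\qquad T_2=\mathbb{R}^d\setminus[-b,b]^d,$$ and let $r=\frac{(b-2a)\sqrt d}{4}$, $R=\frac rH$, $C=\frac{2R}{dH}$. Then $$\beta(T_1,T_2)\le 8\,(1+d\,2^d)\sum_{k=1}^\infty k^{d-1}e^{-F(Ck)}.$$
   Context: Notation. $\mathbb{R}^+=[0,\infty)$, $E=\mathbb{R}^d\times\mathbb{R}^+$, $|\cdot|$ is the Euclidean norm, $B(0,r)=\{x\in\mathbb{R}^d: |x|\le r\}$. A germ is a point $g=(x_g,t_g)\in E$ ($x_g$ = location, $t_g$ = birth time). $\mathcal N$ is a Poisson point process on $E$ (viewed as a random locally finite set of germs) with intensity measure $\Lambda=\lambda^d\times m$, where $\lambda^d$ is Lebesgue measure on $\mathbb{R}^d$ and $m$ is a nonzero measure on $\mathbb{R}^+$ with $m([0,a])<\infty$ for all $a>0$. To each $g\in E$ is associated a (deterministic) function $A_g:\mathbb{R}^d\to\mathbb{R}^+$; the free crystal of $g$ at time $t\ge 0$ is $C_g(t)=\{x: A_g(x)\le t\}$. The random field is $\xi(x)=\inf_{g\in\mathcal N}A_g(x)$. The causal cone is $K_t=\{g\in E: A_g(0)\le t\}$ and $F(t)=\Lambda(K_t)$. The interior diameter $d_g(t)$ is the diameter of the greatest ball centered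 at $x_g$ and included in $C_g(t)$; the exterior diameter $D_g(t)$ is the diameter of the smallest ball centered at $x_g$ containing $C_g(t)$ (both are $0$ when $C_g(t)$ is empty, i.e. $t<t_g$). Assumptions. 1) For all $g=(x_g,t_g)\in E$ and $x\in\mathbb{R}^d$: $A_g(x)=A_{(0,t_g)}(x-x_g)$. 2) For all $g\in E$: $A_g(x_g)=t_g$ and $A_g(x)\ge t_g$ for all $x\in\mathbb{R}^d$. 3) The free crystals $C_g(t)$ are bounded convex sets, and $C_g(s)\subset C_g(t)$ for $0\le s<t$. 4) The functions $x\mapsto A_g(x)$ are continuous and $\partial C_g(t)=\{x: A_g(x)=t\}$. 5) There exists $M>0$ such that for all $t_g\in\mathbb{R}^+$ and $x\in\mathbb{R}^d$: $A_{(0,t_g)}(x)\ge t_g+\frac1M|x|$. 6) For all $g=(0,t_g)$ and all $r>0$ there exists $t>0$ with $C_g(t)\supset B(0,r)$. 7) With $L_g=\{(x,t): A_g(x)\le t\}$ the epigraph of $A_g$: for all $g\in E$ and all $g_1\in L_g$, $A_g(x)\le A_{g_1}(x)$ for all $x\in\mathbb{R}^d$. 8) There exists $A>0$ such that for all $g\in E$ and $t\in\mathbb{R}^+$: $\frac1A D_g(t)\le d_g(t)$. 9) For all $g=(x_g,t_g)\in E$, all $t\ge t_g$ and $h\ge0$: $D_g(t+h)\le D_g(t)+D_{(0,t)}(t+h)$. Absolute regularity coefficient. For disjoint $T_1,T_2\subset\mathbb{R}^d$, $\beta(T_1,T_2)=\|\mathcal P_{T_1\cup T_2}-\mathcal P_{T_1}\times\mathcal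 P_{T_2}\|_{var}$, where $\mathcal P_T$ is the distribution of the restriction $\xi_{|T}$ in the space $\mathcal C(T)$ of continuous real functions on $T$, $\mathcal C(T_1\cup T_2)$ is identified with $\mathcal C(T_1)\times\mathcal C(T_2)$, and $\|\cdot\|_{var}$ is the total variation norm (so $\|P-Q\|_{var}=2\sup_A|P(A)-Q(A)|$ for probability measures). *)

theory Defs
  imports "HOL-Probability.Probability"
begin

section \<open>Germs and free crystals\<close>

text \<open>A germ is a pair of a location and a birth time. A family of crystals is a function
  sending a germ \<open>g\<close> to the arrival-time function \<open>\<A> g\<close>; only its values on \<open>germs\<close> matter.\<close>

type_synonym 'd germ = "(real ^ 'd) \<times> real"

definition germs :: "'d::finite germ set" where
  "germs = UNIV \<times> {0..}"

definition free_crystal :: "('d::finite germ \<Rightarrow> real ^ 'd \<Rightarrow> real) \<Rightarrow> 'd germ \<Rightarrow> real \<Rightarrow> (real ^ 'd) set" where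
  "free_crystal \<A> g t = {x. \<A> g x \<le> t}"

definition epigraph_of :: "('d::finite germ \<Rightarrow> real ^ 'd \<Rightarrow> real) \<Rightarrow> 'd germ \<Rightarrow> 'd germ set" where
  "epigraph_of \<A> g = {(x, t). \<A> g x \<le> t}"

text \<open>Diameters of the greatest ball centred at the germ inside the free crystal and of the
  smallest one around it. Under the assumptions below free crystals are compact, so the extrema
  are attained. The case distinction is needed because the supremum of the empty set
  is unspecified; for the exterior diameter of an empty crystal the infimum is already \<open>0\<close>.\<close>

definition interior_diameter :: "('d::finite germ \<Rightarrow> real ^ 'd \<Rightarrow> real) \<Rightarrow> 'd germ \<Rightarrow> real \<Rightarrow> real" where
  "interior_diameter \<A> g t =
     (if free_crystal \<A> g t = {} then 0
      else 2 * Sup {\<rho>. 0 \<le> \<rho> \<and> cball (fst g) \<rho> \<subseteq> free_crystal \<A> g t})"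

definition exterior_diameter :: "('d::finite germ \<Rightarrow> real ^ 'd \<Rightarrow> real) \<Rightarrow> 'd germ \<Rightarrow> real \<Rightarrow> real" where
  "exterior_diameter \<A> g t =
     2 * Inf {\<rho>. 0 \<le> \<rho> \<and> free_crystal \<A> g t \<subseteq> cball (fst g) \<rho>}"

locale crystal_growth =
  fixes \<A> :: "'d::finite germ \<Rightarrow> real ^ 'd \<Rightarrow> real"
    and M :: real
    and A :: real
  assumes nonneg: "\<And>g x. g \<in> germs \<Longrightarrow> 0 \<le> \<A> g x"
    and translation: "\<And>g x. g \<in> germs \<Longrightarrow> \<A> g x = \<A> (0, snd g) (x - fst g)"
    and birth_at_germ: "\<And>g. g \<in> germs \<Longrightarrow> \<A> g (fst g) = snd g"
    and after_birth: "\<And>g x. g \<in> germs \<Longrightarrow> snd g \<le> \<A> g x"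
    and crystal_bounded: "\<And>g t. g \<in> germs \<Longrightarrow> 0 \<le> t \<Longrightarrow> bounded (free_crystal \<A> g t)"
    and crystal_convex: "\<And>g t. g \<in> germs \<Longrightarrow> 0 \<le> t \<Longrightarrow> convex (free_crystal \<A> g t)"
    and crystal_mono: "\<And>g s t. g \<in> germs \<Longrightarrow> 0 \<le> s \<Longrightarrow> s < t \<Longrightarrow>
          free_crystal \<A> g s \<subseteq> free_crystal \<A> g t"
    and continuous: "\<And>g. g \<in> germs \<Longrightarrow> continuous_on UNIV (\<A> g)"
    and crystal_frontier: "\<And>g t. g \<in> germs \<Longrightarrow> 0 \<le> t \<Longrightarrow>
          frontier (free_crystal \<A> g t) = {x. \<A> g x = t}"
    and M_pos: "0 < M"
    and speed_bound: "\<And>s x. 0 \<le> s \<Longrightarrow> s + norm x / M \<le> \<A> (0, s) x"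
    and covers_balls: "\<And>s r. 0 \<le> s \<Longrightarrow> 0 < r \<Longrightarrow> \<exists>t>0. cball 0 r \<subseteq> free_crystal \<A> (0, s) t"
    and no_overtaking: "\<And>g g1 x. g \<in> germs \<Longrightarrow> g1 \<in> epigraph_of \<A> g \<Longrightarrow> \<A> g x \<le> \<A> g1 x"
    and A_pos: "0 < A"
    and roundness: "\<And>g t. g \<in> germs \<Longrightarrow> 0 \<le> t \<Longrightarrow>
          exterior_diameter \<A> g t / A \<le> interior_diameter \<A> g t"
    and diameter_growth: "\<And>g t h. g \<in> germs \<Longrightarrow> snd g \<le> t \<Longrightarrow> 0 \<le> h \<Longrightarrow>
          exterior_diameter \<A> g (t + h)
            \<le> exterior_diameter \<A> g t + exterior_diameter \<A> (0, t) (t + h)"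

section \<open>The Poisson process of germs and the crystallization field\<close>

text \<open>Points are counted in \<open>ennreal\<close>, because \<open>card\<close> is \<open>0\<close> on infinite sets.\<close>

definition point_count :: "('w \<Rightarrow> 'a set) \<Rightarrow> 'a set \<Rightarrow> 'w \<Rightarrow> ennreal" where
  "point_count N B \<omega> = emeasure (count_space UNIV) (N \<omega> \<inter> B)"

definition poisson_process ::
    "'w measure \<Rightarrow> 'a::metric_space measure \<Rightarrow> ('w \<Rightarrow> 'a set) \<Rightarrow> bool" where
  "poisson_process P \<Lambda> N \<longleftrightarrow>
     prob_space P \<and>
     (\<forall>\<omega>\<in>space P. N \<omega> \<subseteq> space \<Lambda> \<and> (\<forall>B. bounded B \<longrightarrow> finite (N \<omega> \<inter> B))) \<and>
     (\<forall>B\<in>sets \<Lambda>. point_count N B \<in> borel_measurable P) \<and>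
     (\<forall>B\<in>sets \<Lambda>. emeasure \<Lambda> B < \<infinity> \<longrightarrow>
        (\<forall>n::nat. measure P {\<omega>\<in>space P. point_count N B \<omega> = of_nat n}
                    = exp (- measure \<Lambda> B) * measure \<Lambda> B ^ n / fact n)) \<and>
     (\<forall>B\<in>sets \<Lambda>. emeasure \<Lambda> B = \<infinity> \<longrightarrow> (AE \<omega> in P. point_count N B \<omega> = \<infinity>)) \<and>
     (\<forall>\<B>. finite \<B> \<longrightarrow> \<B> \<subseteq> sets \<Lambda> \<longrightarrow> disjoint \<B> \<longrightarrow>
        prob_space.indep_vars P (\<lambda>_. borel) (point_count N) \<B>)"

text \<open>The intensity measure lives on \<open>germs\<close> when \<open>m\<close> is a measure on \<open>{0..}\<close>.\<close>

definition germ_intensity :: "real measure \<Rightarrow> 'd::finite germ measure" where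
  "germ_intensity m = lborel \<Otimes>\<^sub>M m"

definition crystal_field ::
    "('d::finite germ \<Rightarrow> real ^ 'd \<Rightarrow> real) \<Rightarrow> ('w \<Rightarrow> 'd germ set) \<Rightarrow> 'w \<Rightarrow> real ^ 'd \<Rightarrow> real" where
  "crystal_field \<A> N \<omega> x = (INF g\<in>N \<omega>. \<A> g x)"

definition causal_cone :: "('d::finite germ \<Rightarrow> real ^ 'd \<Rightarrow> real) \<Rightarrow> real \<Rightarrow> 'd germ set" where
  "causal_cone \<A> t = {g\<in>germs. \<A> g 0 \<le> t}"

text \<open>For a \<open>crystal_growth\<close> family the causal cone at time \<open>t\<close> is a measurable subset of
  \<open>cball 0 (M * t) \<times> {0..t}\<close>, so that the real-valued \<open>measure\<close> agrees with the extended one.\<close>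

definition cone_mass :: "('d::finite germ \<Rightarrow> real ^ 'd \<Rightarrow> real) \<Rightarrow> real measure \<Rightarrow> real \<Rightarrow> real" where
  "cone_mass \<A> m t = measure (germ_intensity m) (causal_cone \<A> t)"

section \<open>Absolute regularity\<close>

text \<open>The space of continuous functions on \<open>T\<close>, represented by functions that are \<open>undefined\<close>
  outside \<open>T\<close>, with the \<open>\<sigma>\<close>-algebra generated by the evaluations.\<close>

definition continuous_space :: "'a::topological_space set \<Rightarrow> ('a \<Rightarrow> real) measure" where
  "continuous_space T = restrict_space (\<Pi>\<^sub>M x\<in>T. borel) {f. continuous_on T f}"

definition field_law ::
    "'w measure \<Rightarrow> ('w \<Rightarrow> 'a::topological_space \<Rightarrow> real) \<Rightarrow> 'a set \<Rightarrow> ('a \<Rightarrow> real) measure" where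
  "field_law P X T = distr P (continuous_space T) (\<lambda>\<omega>. restrict (X \<omega>) T)"

text \<open>The total variation norm of \<open>\<mu> - \<nu>\<close>, for finite measures on the same
  \<open>\<sigma>\<close>-algebra, normalised as the total mass of the variation measure.\<close>

definition variation_norm_diff :: "'a measure \<Rightarrow> 'a measure \<Rightarrow> ennreal" where
  "variation_norm_diff \<mu> \<nu> =
     (SUP \<B>\<in>{\<B>. finite \<B> \<and> disjoint \<B> \<and> \<B> \<subseteq> sets \<mu> \<and> \<Union>\<B> = space \<mu>}.
        \<Sum>B\<in>\<B>. ennreal \<bar>measure \<mu> B - measure \<nu> B\<bar>)"

lemma variation_norm_diff_prob_space:
  assumes "prob_space \<mu>" "prob_space \<nu>" and sets: "sets \<mu> = sets \<nu>"
  shows "variation_norm_diff \<mu> \<nu> = (SUP B\<in>sets \<mu>. ennreal (2 * \<bar>measure \<mu> B - measure \<nu> B\<bar>))"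
proof -
  interpret \<mu>: prob_space \<mu> by fact
  interpret \<nu>: prob_space \<nu> by fact
  have space: "space \<mu> = space \<nu>"
    using sets by (rule sets_eq_imp_space_eq)
  have compl: "measure \<mu> (space \<mu> - B) - measure \<nu> (space \<mu> - B) = - (measure \<mu> B - measure \<nu> B)"
    if "B \<in> sets \<mu>" for B
    using that sets space \<mu>.prob_compl[of B] \<nu>.prob_compl[of B] by simp
  show ?thesis
    unfolding variation_norm_diff_def
  proof (rule antisym; rule SUP_least)
    fix \<B> assume "\<B> \<in> {\<B>. finite \<B> \<and> disjoint \<B> \<and> \<B> \<subseteq> sets \<mu> \<and> \<Union>\<B> = space \<mu>}"
    then have fin: "finite \<B>" and disj: "disjoint \<B>" and sub: "\<B> \<subseteq> sets \<mu>"
      and cover: "\<Union>\<B> = space \<mu>" by auto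
    define \<delta> where "\<delta> B = measure \<mu> B - measure \<nu> B" for B
    define \<P> where "\<P> = {B\<in>\<B>. 0 \<le> \<delta> B}"
    have union: "\<delta> (\<Union>\<C>) = (\<Sum>B\<in>\<C>. \<delta> B)" if "\<C> \<subseteq> \<B>" for \<C>
    proof -
      have fam: "disjoint_family_on (\<lambda>B. B) \<C>" "finite \<C>" "\<C> \<subseteq> sets \<mu>"
        using that fin sub disj unfolding disjoint_family_on_def disjoint_def
        by (blast, blast intro: finite_subset, blast)
      have "measure \<mu> (\<Union>\<C>) = (\<Sum>B\<in>\<C>. measure \<mu> B)"
        using \<mu>.finite_measure_finite_Union[OF fam(2) _ fam(1)] fam(3) by simp
      moreover have "measure \<nu> (\<Union>\<C>) = (\<Sum>B\<in>\<C>. measure \<nu> B)"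
        using \<nu>.finite_measure_finite_Union[OF fam(2) _ fam(1)] fam(3) sets by simp
      ultimately show ?thesis by (simp add: \<delta>_def sum_subtractf)
    qed
    have P: "\<P> \<subseteq> \<B>" "finite \<P>" "\<Union>\<P> \<in> sets \<mu>"
      using fin sub by (auto simp: \<P>_def)
    have "(\<Sum>B\<in>\<B>. \<bar>\<delta> B\<bar>) = (\<Sum>B\<in>\<P>. \<bar>\<delta> B\<bar>) + (\<Sum>B\<in>\<B> - \<P>. \<bar>\<delta> B\<bar>)"
      using P fin by (simp add: sum.subset_diff)
    also have "\<dots> = (\<Sum>B\<in>\<P>. \<delta> B) - (\<Sum>B\<in>\<B> - \<P>. \<delta> B)"
      by (auto simp: \<P>_def simp flip: sum_negf intro!: sum.cong arg_cong2[where f = "(+)"])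
    also have "\<dots> = 2 * (\<Sum>B\<in>\<P>. \<delta> B) - (\<Sum>B\<in>\<B>. \<delta> B)"
      using P fin by (simp add: sum_diff)
    also have "(\<Sum>B\<in>\<B>. \<delta> B) = 0"
      using union[of \<B>] cover \<mu>.prob_space \<nu>.prob_space space by (simp add: \<delta>_def)
    finally have "(\<Sum>B\<in>\<B>. \<bar>\<delta> B\<bar>) \<le> 2 * \<bar>\<delta> (\<Union>\<P>)\<bar>"
      using union[OF P(1)] by simp
    then have "(\<Sum>B\<in>\<B>. ennreal \<bar>\<delta> B\<bar>) \<le> ennreal (2 * \<bar>\<delta> (\<Union>\<P>)\<bar>)"
      by (simp only: sum_ennreal abs_ge_zero ennreal_leI)
    also have "\<dots> \<le> (SUP B\<in>sets \<mu>. ennreal (2 * \<bar>\<delta> B\<bar>))"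
      using P(3) by (intro SUP_upper)
    finally show "(\<Sum>B\<in>\<B>. ennreal \<bar>measure \<mu> B - measure \<nu> B\<bar>)
        \<le> (SUP B\<in>sets \<mu>. ennreal (2 * \<bar>measure \<mu> B - measure \<nu> B\<bar>))"
      by (simp add: \<delta>_def)
  next
    fix B assume B: "B \<in> sets \<mu>"
    have ne: "B \<noteq> space \<mu> - B"
      using \<mu>.not_empty sets.sets_into_space[OF B] by blast
    have "ennreal (2 * \<bar>measure \<mu> B - measure \<nu> B\<bar>)
        = (\<Sum>B\<in>{B, space \<mu> - B}. ennreal \<bar>measure \<mu> B - measure \<nu> B\<bar>)"
      using ne compl[OF B] by (simp flip: ennreal_plus)
    also have "\<dots> \<le> (SUP \<B>\<in>{\<B>. finite \<B> \<and> disjoint \<B> \<and> \<B> \<subseteq> sets \<mu> \<and> \<Union>\<B> = space \<mu>}.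
        \<Sum>B\<in>\<B>. ennreal \<bar>measure \<mu> B - measure \<nu> B\<bar>)"
      using B sets.sets_into_space[OF B]
      by (intro SUP_upper) (auto simp: disjoint_def)
    finally show "ennreal (2 * \<bar>measure \<mu> B - measure \<nu> B\<bar>) \<le> \<dots>" .
  qed
qed

text \<open>The law of the field on \<open>T1 \<union> T2\<close> is transported to the product space along
  \<open>f \<mapsto> (f|T1, f|T2)\<close>. This is an identification when \<open>T1\<close> and \<open>T2\<close> are
  separated, as \<open>{-a..a}\<^sup>d\<close> and the complement of \<open>{-b..b}\<^sup>d\<close> are for \<open>a < b\<close>.\<close>

definition absolute_regularity ::
    "'w measure \<Rightarrow> ('w \<Rightarrow> 'a::topological_space \<Rightarrow> real) \<Rightarrow> 'a set \<Rightarrow> 'a set \<Rightarrow> ennreal" where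
  "absolute_regularity P X T1 T2 =
     variation_norm_diff
       (distr (field_law P X (T1 \<union> T2)) (continuous_space T1 \<Otimes>\<^sub>M continuous_space T2)
          (\<lambda>f. (restrict f T1, restrict f T2)))
       (field_law P X T1 \<Otimes>\<^sub>M field_law P X T2)"

end

theory Submission
  imports Defs
begin

text \<open>Place a cubic lattice of seeds around the origin and give a seed in the \<open>k\<close>-th lattice shell
  the time \<open>C k\<close> to be reached. Some seed fails with probability at most the sum of
  \<open>d 2\<^sup>d k\<^sup>d\<^sup>-\<^sup>1 exp (- F (C k))\<close>, because a shell has at most \<open>d 2\<^sup>d k\<^sup>d\<^sup>-\<^sup>1\<close> points. If no seed fails,
  then the crystals reaching the seeds near a point shield it from all germs beyond some distance,
  by roundness and assumptions 7 and 9. So with \<open>c = (a + b) / 2\<close> the field on \<open>T1\<close> is determined by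
  the germs located in \<open>[-c, c]\<^sup>d\<close> and the field on \<open>T2\<close> by the others. The fields built from these two
  disjoint families of germs are independent, and comparing joint and product laws with theirs
  costs three times the failure probability.\<close>

section \<open>Shielding\<close>

text \<open>This is the causal cone with its apex moved from the origin to \<open>x\<close>.\<close>

definition reaching_germs ::
    "('d::finite germ \<Rightarrow> real ^ 'd \<Rightarrow> real) \<Rightarrow> real ^ 'd \<Rightarrow> real \<Rightarrow> 'd germ set" where
  "reaching_germs \<A> x t = {g\<in>germs. \<A> g x \<le> t}"

lemma causal_cone_eq: "causal_cone \<A> t = reaching_germs \<A> 0 t"
  by (simp add: causal_cone_def reaching_germs_def)

context crystal_growth
begin

text \<open>Assumption 5, carried to the germ's own location by translation: crystals spread with
  speed at most \<open>M\<close>.\<close>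

lemma dist_le_speed:
  assumes "g \<in> germs" "\<A> g x \<le> t"
  shows "dist (fst g) x \<le> M * (t - snd g)"
proof -
  have "snd g + norm (x - fst g) / M \<le> \<A> g x"
    using speed_bound[of "snd g" "x - fst g"] translation[OF assms(1), of x] assms(1)
    by (auto simp: germs_def)
  then have "norm (x - fst g) / M \<le> t - snd g"
    using assms(2) by linarith
  then show ?thesis
    using M_pos by (simp add: dist_norm norm_minus_commute field_simps)
qed

lemma exterior_diameter_ge:
  assumes "g \<in> germs" "0 \<le> t" "x \<in> free_crystal \<A> g t"
  shows "2 * dist (fst g) x \<le> exterior_diameter \<A> g t"
proof -
  let ?S = "{\<rho>. 0 \<le> \<rho> \<and> free_crystal \<A> g t \<subseteq> cball (fst g) \<rho>}"
  obtain e where "free_crystal \<A> g t \<subseteq> cball (fst g) e"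
    using crystal_bounded[OF assms(1,2)] unfolding bounded_any_center[of _ "fst g"]
    by (auto simp: subset_iff)
  \<comment> \<open>The radius \<open>e\<close> may be negative when the crystal is empty. A
    nonempty set of radii is what makes \<open>Inf\<close> a genuine greatest lower bound.\<close>
  then have "max 0 e \<in> ?S"
    by auto
  then have "?S \<noteq> {}"
    by (metis empty_iff)
  then have "dist (fst g) x \<le> Inf ?S"
    using assms(3) by (intro cInf_greatest) auto
  then show ?thesis
    by (simp add: exterior_diameter_def)
qed

lemma exterior_diameter_le:
  assumes "free_crystal \<A> g t \<subseteq> cball (fst g) \<rho>" "0 \<le> \<rho>"
  shows "exterior_diameter \<A> g t \<le> 2 * \<rho>"
  unfolding exterior_diameter_def using assms
  by (intro mult_left_mono cInf_lower bdd_belowI[of _ 0]) auto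

lemma germ_mem_crystal:
  assumes "g \<in> germs" "free_crystal \<A> g t \<noteq> {}"
  shows "fst g \<in> free_crystal \<A> g t"
proof -
  obtain x where "\<A> g x \<le> t"
    using assms(2) by (auto simp: free_crystal_def)
  then show ?thesis
    using after_birth[OF assms(1), of x] birth_at_germ[OF assms(1)] by (simp add: free_crystal_def)
qed

text \<open>Because the inequality is strict, some admissible radius already exceeds the distance,
  so the supremum need not be attained. An empty crystal has interior diameter \<open>0\<close> and
  is thereby excluded.\<close>

lemma mem_crystal_if_interior:
  assumes g: "g \<in> germs" and x: "2 * dist (fst g) x < interior_diameter \<A> g t"
  shows "x \<in> free_crystal \<A> g t"
proof -
  let ?S = "{\<rho>. 0 \<le> \<rho> \<and> cball (fst g) \<rho> \<subseteq> free_crystal \<A> g t}"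
  have ne: "free_crystal \<A> g t \<noteq> {}"
    using x by (auto simp: interior_diameter_def not_less split: if_splits)
  have "0 \<in> ?S"
    using germ_mem_crystal[OF g ne] by auto
  moreover have "dist (fst g) x < Sup ?S"
    using x ne by (simp add: interior_diameter_def)
  ultimately obtain \<rho> where "\<rho> \<in> ?S" "dist (fst g) x < \<rho>"
    using less_cSupD[of ?S "dist (fst g) x"] by (metis (no_types, lifting) empty_iff)
  then show ?thesis
    by auto
qed

text \<open>The interior diameter never exceeds the exterior one, so roundness forces this as soon
  as some exterior diameter is positive. A time at which the crystal covers the unit ball provides
  one.\<close>

lemma A_ge_1: "1 \<le> A"
proof -
  let ?g = "(0, 0) :: 'd germ"
  have g: "?g \<in> germs"
    by (simp add: germs_def)
  obtain t where t: "0 < t" "cball 0 1 \<subseteq> free_crystal \<A> ?g t"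
    using covers_balls[of 0 1] by auto
  let ?S = "{\<rho>. 0 \<le> \<rho> \<and> cball (fst ?g) \<rho> \<subseteq> free_crystal \<A> ?g t}"
  have le: "2 * \<rho> \<le> exterior_diameter \<A> ?g t" if \<rho>: "\<rho> \<in> ?S" for \<rho>
  proof -
    obtain x :: "real ^ 'd" where "norm x = \<rho>"
      using vector_choose_size[of \<rho>] \<rho> by auto
    then show ?thesis
      using \<rho> exterior_diameter_ge[OF g, of t x] t(1) by auto
  qed
  have one: "1 \<in> ?S"
    using t(2) by simp
  then have "?S \<noteq> {}"
    by (metis empty_iff)
  moreover have "\<rho> \<le> exterior_diameter \<A> ?g t / 2" if "\<rho> \<in> ?S" for \<rho>
    using le[OF that] by simp
  ultimately have "Sup ?S \<le> exterior_diameter \<A> ?g t / 2"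
    by (rule cSup_least)
  moreover have "free_crystal \<A> ?g t \<noteq> {}"
    using t(2) by auto
  ultimately have "interior_diameter \<A> ?g t \<le> exterior_diameter \<A> ?g t"
    by (simp add: interior_diameter_def)
  then have "exterior_diameter \<A> ?g t / A \<le> exterior_diameter \<A> ?g t"
    using roundness[OF g, of t] t(1) by linarith
  moreover have "0 < exterior_diameter \<A> ?g t"
    using le[OF one] by linarith
  ultimately show ?thesis
    using A_pos by (simp add: field_simps)
qed

text \<open>At time \<open>s'\<close> the crystal of the earlier germ already contains its own
  location, so the later germ lies in its epigraph and assumption 7 applies.\<close>

lemma antimono_birth:
  assumes "0 \<le> s" "s \<le> s'"
  shows "\<A> (y, s) x \<le> \<A> (y, s') x"
  using assms birth_at_germ[of "(y, s)"]
  by (intro no_overtaking) (auto simp: germs_def epigraph_of_def)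

text \<open>If \<open>g\<close> has reached \<open>y\<close> by time \<open>t\<close>, it contains a crystal born at \<open>(y, t)\<close>. By the time a
  distant germ \<open>h\<close> reaches \<open>x\<close>, assumption 9 makes the exterior diameter of that crystal comparable
  to the distance travelled by \<open>h\<close>, and roundness turns this into a ball around \<open>y\<close> containing \<open>x\<close>.\<close>

lemma shielding:
  assumes g: "g \<in> germs" and h: "h \<in> germs" and t: "0 \<le> t" and gy: "\<A> g y \<le> t"
    and far: "A * dist y x + M * t < dist (fst h) x"
  shows "\<A> g x \<le> \<A> h x"
proof -
  define s where "s = \<A> h x"
  \<comment> \<open>By translation this one germ stands for every crystal born at time
    \<open>t\<close>: the one at \<open>y\<close> and the one at the location of
    \<open>h\<close>.\<close>
  let ?g0 = "(0, t) :: 'd germ"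
  have g0: "?g0 \<in> germs"
    using t by (simp add: germs_def)
  have sh: "0 \<le> snd h"
    using h by (auto simp: germs_def)
  have xs: "x \<in> free_crystal \<A> h s"
    by (simp add: free_crystal_def s_def)
  have within: "dist (fst h) z \<le> M * u" if "\<A> h z \<le> u" for z u
    using dist_le_speed[OF h that] mult_left_mono[of "u - snd h" u M] M_pos sh by linarith
  have "dist (fst h) x \<le> M * s"
    using within[of x s] by (simp add: s_def)
  then have "M * t < M * s"
    using far mult_nonneg_nonneg[OF less_imp_le[OF A_pos] zero_le_dist[of y x]] by linarith
  then have ts: "t < s"
    using M_pos by simp
  \<comment> \<open>If \<open>h\<close> is born by time \<open>t\<close>, its crystal at
    \<open>t\<close> has radius at most \<open>M * t\<close>, and assumption 9 attributes the
    remaining growth to a crystal born at \<open>t\<close>. Otherwise a crystal born at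
    \<open>t\<close> in the same place is ahead of \<open>h\<close>, and the term
    \<open>M * t\<close> is pure slack.\<close>
  have ext: "2 * (dist (fst h) x - M * t) \<le> exterior_diameter \<A> ?g0 s"
  proof (cases "snd h \<le> t")
    case True
    have "free_crystal \<A> h t \<subseteq> cball (fst h) (M * t)"
      using within by (auto simp: free_crystal_def)
    then have "exterior_diameter \<A> h t \<le> 2 * (M * t)"
      using M_pos t by (intro exterior_diameter_le) auto
    moreover have "2 * dist (fst h) x \<le> exterior_diameter \<A> h s"
      using exterior_diameter_ge[OF h _ xs] t ts by simp
    ultimately show ?thesis
      using diameter_growth[OF h True, of "s - t"] ts by simp
  next
    case False
    have "\<A> ?g0 (x - fst h) \<le> \<A> (0, snd h) (x - fst h)"
      using False t by (intro antimono_birth) auto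
    then have "x - fst h \<in> free_crystal \<A> ?g0 s"
      using translation[OF h, of x] by (simp add: free_crystal_def s_def)
    from exterior_diameter_ge[OF g0 _ this] have "2 * dist (fst h) x \<le> exterior_diameter \<A> ?g0 s"
      using t ts by (simp add: dist_norm norm_minus_commute)
    then show ?thesis
      using mult_nonneg_nonneg[OF less_imp_le[OF M_pos] t] unfolding right_diff_distrib by linarith
  qed
  have "2 * dist y x < 2 * (dist (fst h) x - M * t) / A"
    using far A_pos by (simp add: field_simps)
  also have "\<dots> \<le> exterior_diameter \<A> ?g0 s / A"
    using ext A_pos by (intro divide_right_mono) auto
  also have "\<dots> \<le> interior_diameter \<A> ?g0 s"
    using roundness[OF g0, of s] t ts by simp
  finally have "x - y \<in> free_crystal \<A> ?g0 s"
    using mem_crystal_if_interior[OF g0, of "x - y" s] by (simp add: dist_norm norm_minus_commute)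
  moreover have "\<A> g x \<le> \<A> (y, t) x"
    using gy by (intro no_overtaking g) (simp add: epigraph_of_def)
  ultimately show ?thesis
    using translation[of "(y, t)" x] t by (simp add: free_crystal_def germs_def s_def)
qed

lemma field_bdd_below: "S \<subseteq> germs \<Longrightarrow> bdd_below ((\<lambda>g. \<A> g x) ` S)"
  using nonneg by (intro bdd_belowI[of _ 0]) auto

text \<open>Dropping germs that are dominated at \<open>x\<close> leaves the infimum unchanged.
  Without any germs both sides are the same unspecified value \<open>Inf {}\<close>.\<close>

lemma crystal_field_restrict_eq:
  assumes "N \<omega> \<subseteq> germs"
    and "\<And>h. h \<in> N \<omega> \<Longrightarrow> h \<notin> S \<Longrightarrow> \<exists>g\<in>N \<omega> \<inter> S. \<A> g x \<le> \<A> h x"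
  shows "crystal_field \<A> (\<lambda>\<omega>. N \<omega> \<inter> S) \<omega> x = crystal_field \<A> N \<omega> x"
proof (cases "N \<omega> = {}")
  case False
  then have ne: "N \<omega> \<inter> S \<noteq> {}"
    using assms(2) by blast
  have "N \<omega> \<inter> S \<subseteq> germs"
    using assms(1) by blast
  note bdd = field_bdd_below[OF assms(1), of x] field_bdd_below[OF this, of x]
  show ?thesis
    unfolding crystal_field_def
  proof (rule antisym)
    show "(INF g\<in>N \<omega> \<inter> S. \<A> g x) \<le> (INF g\<in>N \<omega>. \<A> g x)"
      using False assms(2) by (intro cINF_mono bdd) blast+
    show "(INF g\<in>N \<omega>. \<A> g x) \<le> (INF g\<in>N \<omega> \<inter> S. \<A> g x)"
      using ne by (intro cINF_superset_mono bdd) auto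
  qed
qed (simp add: crystal_field_def)

end

section \<open>Continuity and measurability\<close>

lemma continuous_on_INF_finite:
  fixes f :: "'i \<Rightarrow> 'a::topological_space \<Rightarrow> real"
  assumes "finite F" "F \<noteq> {}" "\<And>i. i \<in> F \<Longrightarrow> continuous_on S (f i)"
  shows "continuous_on S (\<lambda>x. INF i\<in>F. f i x)"
  using assms
proof (induction F rule: finite_ne_induct)
  case (insert i F)
  then have "(INF j\<in>insert i F. f j x) = min (f i x) (INF j\<in>F. f j x)" for x
    by (subst cINF_insert) (auto simp: inf_min)
  with insert show ?case
    by (auto intro!: continuous_on_min)
qed simp

context crystal_growth
begin

lemma reaching_germs_subset: "reaching_germs \<A> x t \<subseteq> cball x (M * t) \<times> {0..t}"
proof
  fix g assume "g \<in> reaching_germs \<A> x t"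
  then have g: "g \<in> germs" "\<A> g x \<le> t"
    by (auto simp: reaching_germs_def)
  then have "0 \<le> snd g" "snd g \<le> t"
    using after_birth[of g x] by (auto simp: germs_def)
  moreover have "dist (fst g) x \<le> M * t"
    using dist_le_speed[OF g] mult_left_mono[of "t - snd g" t M] M_pos \<open>0 \<le> snd g\<close> by linarith
  ultimately show "g \<in> cball x (M * t) \<times> {0..t}"
    by (cases g) (simp add: dist_commute)
qed

lemma finite_reaching_germs:
  assumes "\<And>B. bounded B \<Longrightarrow> finite (S \<inter> B)"
  shows "finite (S \<inter> reaching_germs \<A> x t)"
proof -
  have "bounded (reaching_germs \<A> x t)"
    by (rule bounded_subset[OF _ reaching_germs_subset]) (simp add: bounded_Times)
  then show ?thesis
    by (rule assms)
qed

text \<open>Only finitely many germs reach \<open>x\<close> by time \<open>t + 1\<close>, so the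
  infimum is attained. This expresses the level sets of the field through void events.\<close>

lemma crystal_field_le_iff:
  assumes N: "N \<omega> \<subseteq> germs" and fin: "\<And>B. bounded B \<Longrightarrow> finite (N \<omega> \<inter> B)" and ne: "N \<omega> \<noteq> {}"
  shows "crystal_field \<A> N \<omega> x \<le> t \<longleftrightarrow> N \<omega> \<inter> reaching_germs \<A> x t \<noteq> {}"
proof
  assume le: "crystal_field \<A> N \<omega> x \<le> t"
  let ?F = "N \<omega> \<inter> reaching_germs \<A> x (t + 1)"
  have "(INF g\<in>N \<omega>. \<A> g x) < t + 1"
    using le by (simp add: crystal_field_def)
  then obtain g1 where "g1 \<in> N \<omega>" "\<A> g1 x < t + 1"
    using cINF_less_iff[OF ne field_bdd_below[OF N]] by auto
  then have F: "finite ?F" "?F \<noteq> {}"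
    using finite_reaching_germs[OF fin] N by (auto simp: reaching_germs_def)
  then obtain g where g: "g \<in> ?F" "\<And>h. h \<in> ?F \<Longrightarrow> \<A> g x \<le> \<A> h x"
    using arg_min_if_finite[of ?F "\<lambda>g. \<A> g x"] arg_min_least[of ?F _ "\<lambda>g. \<A> g x"] by metis
  have "\<A> g x \<le> \<A> h x" if "h \<in> N \<omega>" for h
    using g(2)[of h] that N g(1) by (cases "\<A> h x \<le> t + 1") (auto simp: reaching_germs_def)
  then have "\<A> g x \<le> crystal_field \<A> N \<omega> x"
    unfolding crystal_field_def by (intro cINF_greatest ne)
  then show "N \<omega> \<inter> reaching_germs \<A> x t \<noteq> {}"
    using g(1) le by (auto simp: reaching_germs_def)
next
  assume "N \<omega> \<inter> reaching_germs \<A> x t \<noteq> {}"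
  then obtain g where "g \<in> N \<omega>" "\<A> g x \<le> t"
    by (auto simp: reaching_germs_def)
  then show "crystal_field \<A> N \<omega> x \<le> t"
    unfolding crystal_field_def by (intro cINF_lower2 field_bdd_below N)
qed

text \<open>Let \<open>K\<close> bound the arrival times of one fixed germ on the unit ball around
  \<open>x0\<close>. Only germs arriving somewhere in that ball by time \<open>K\<close> can matter
  there; they form a bounded set, so the field is locally a finite minimum of continuous
  functions.\<close>

lemma continuous_on_crystal_field:
  assumes N: "N \<omega> \<subseteq> germs" and fin: "\<And>B. bounded B \<Longrightarrow> finite (N \<omega> \<inter> B)"
  shows "continuous_on UNIV (crystal_field \<A> N \<omega>)"
proof (cases "N \<omega> = {}")
  case True
  then show ?thesis
    by (simp add: crystal_field_def[abs_def])
next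
  case False
  then obtain g0 where g0: "g0 \<in> N \<omega>"
    by blast
  have "isCont (crystal_field \<A> N \<omega>) x0" for x0
  proof -
    have compact: "compact (\<A> g0 ` cball x0 1)"
      using continuous[of g0] g0 N by (intro compact_continuous_image) (auto intro: continuous_on_subset)
    obtain K where K: "\<And>x. x \<in> cball x0 1 \<Longrightarrow> \<A> g0 x \<le> K"
      using bounded_imp_bdd_above[OF compact_imp_bounded[OF compact]] by (metis bdd_above.E image_eqI)
    define F where "F = {g \<in> germs. \<exists>x\<in>cball x0 1. \<A> g x \<le> K}"
    have "F \<subseteq> cball x0 (M * K + 1) \<times> {0..K}"
    proof
      fix g assume "g \<in> F"
      then obtain x where x: "x \<in> cball x0 1" and g: "g \<in> reaching_germs \<A> x K"
        by (auto simp: F_def reaching_germs_def)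
      have "g \<in> cball x (M * K) \<times> {0..K}"
        using g by (rule subsetD[OF reaching_germs_subset])
      then show "g \<in> cball x0 (M * K + 1) \<times> {0..K}"
        using x dist_triangle[of x0 "fst g" x] by (cases g) auto
    qed
    then have "bounded F"
      by (rule bounded_subset[rotated]) (simp add: bounded_Times)
    then have "finite (N \<omega> \<inter> F)"
      by (rule fin)
    moreover have "g0 \<in> F"
      using g0 N K[of x0] by (auto simp: F_def intro!: bexI[of _ x0])
    ultimately have "continuous_on (ball x0 1) (\<lambda>x. INF g\<in>N \<omega> \<inter> F. \<A> g x)"
      using g0 N continuous by (intro continuous_on_INF_finite) (blast intro: continuous_on_subset)+
    moreover have "(INF g\<in>N \<omega> \<inter> F. \<A> g x) = crystal_field \<A> N \<omega> x" if x: "x \<in> ball x0 1" for x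
    proof -
      have x': "x \<in> cball x0 1"
        using x by simp
      have "\<exists>g\<in>N \<omega> \<inter> F. \<A> g x \<le> \<A> h x" if h: "h \<in> N \<omega>" "h \<notin> F" for h
      proof (rule bexI)
        have "\<not> \<A> h x \<le> K"
          using h N x' unfolding F_def by blast
        then show "\<A> g0 x \<le> \<A> h x"
          using K[OF x'] by linarith
      qed (use g0 \<open>g0 \<in> F\<close> in simp)
      from crystal_field_restrict_eq[of N \<omega> F x, OF N this] show ?thesis
        by (simp add: crystal_field_def)
    qed
    ultimately have "continuous_on (ball x0 1) (crystal_field \<A> N \<omega>)"
      using continuous_on_cong by (metis (no_types, lifting))
    then show ?thesis
      by (simp add: continuous_on_eq_continuous_at)
  qed
  then show ?thesis
    by (simp add: continuous_at_imp_continuous_on)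
qed

text \<open>For fixed location the sets \<open>{s. \<A> (y, s) x < u}\<close> are down-closed, and for fixed birth time
  the sets \<open>{y. \<A> (y, s) x < u}\<close> are open. A countable base therefore exhausts the strict
  version by countably many measurable rectangles.\<close>

lemma sets_reaching_germs:
  assumes m: "sets m = sets (restrict_space borel {0..})"
  shows "reaching_germs \<A> x t \<in> sets (germ_intensity m)"
proof -
  obtain \<B> :: "(real ^ 'd) set set" where \<B>: "countable \<B>" "topological_basis \<B>"
    using ex_countable_basis by auto
  define S where "S u B = {s \<in> {0..}. \<forall>y\<in>B. \<A> (y, s) x < u}" for u B
  define U where "U u = (\<Union>B\<in>\<B>. B \<times> S u B)" for u
  have S: "S u B \<in> sets m" for u B
  proof -
    have "is_interval (S u B)"
      unfolding is_interval_1
    proof (intro ballI allI impI)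
      fix s s' v assume "s \<in> S u B" "s' \<in> S u B" "s \<le> v \<and> v \<le> s'"
      then show "v \<in> S u B"
        using antimono_birth[of v s' _ x] by (fastforce simp: S_def intro: le_less_trans)
    qed
    then show ?thesis
      using real_interval_borel_measurable[of "S u B"] unfolding m
      by (subst sets_restrict_space_iff) (auto simp: S_def)
  qed
  have "B \<times> S u B \<in> sets (germ_intensity m)" if "B \<in> \<B>" for u B
    using topological_basis_open[OF \<B>(2) that] S unfolding germ_intensity_def by auto
  then have U: "U u \<in> sets (germ_intensity m)" for u
    unfolding U_def using \<B>(1) by (intro sets.countable_UN') auto
  have U_eq: "U u = {g \<in> germs. \<A> g x < u}" for u
  proof (intro set_eqI iffI)
    fix g assume g: "g \<in> {g \<in> germs. \<A> g x < u}"
    obtain y s where ys: "g = (y, s)"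
      by (cases g)
    have s: "(z, s) \<in> germs" for z
      using g by (auto simp: germs_def ys)
    \<comment> \<open>Assumption 4 gives continuity in the point reached; translation turns it into
      continuity in the location of the germ.\<close>
    have "\<A> (z, s) x = \<A> (0, s) (x - z)" for z
      using translation[OF s] by simp
    moreover have "continuous_on UNIV (\<lambda>z. \<A> (0, s) (x - z))"
      using continuous[OF s] by (rule continuous_on_compose2) (auto intro!: continuous_intros)
    ultimately have "open {z. \<A> (z, s) x < u}"
      by (simp add: open_Collect_less)
    then obtain B where "B \<in> \<B>" "y \<in> B" "B \<subseteq> {z. \<A> (z, s) x < u}"
      using topological_basisE[OF \<B>(2), of "{z. \<A> (z, s) x < u}" y] g ys by auto
    then show "g \<in> U u"
      using g by (auto simp: U_def S_def germs_def ys)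
  qed (auto simp: U_def S_def germs_def)
  have "reaching_germs \<A> x t = (\<Inter>n::nat. U (t + 1 / Suc n))"
  proof (intro set_eqI iffI)
    fix g assume g: "g \<in> (\<Inter>n::nat. U (t + 1 / Suc n))"
    then have *: "\<A> g x < t + 1 / Suc n" for n :: nat
      by (auto simp: U_eq)
    have "\<A> g x \<le> t"
    proof (rule ccontr)
      assume "\<not> \<A> g x \<le> t"
      then obtain n :: nat where "1 / Suc n < \<A> g x - t"
        using nat_approx_posE[of "\<A> g x - t"] by auto
      then show False
        using *[of n] by simp
    qed
    then show "g \<in> reaching_germs \<A> x t"
      using g by (auto simp: U_eq reaching_germs_def)
  qed (auto simp: U_eq reaching_germs_def intro: add_pos_pos le_less_trans)
  then show ?thesis
    using U by auto
qed

end

section \<open>Finiteness and translation invariance of the intensity\<close>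

lemma sigma_finite_locally_finite:
  assumes sets: "sets m = sets (restrict_space borel {0::real..})"
    and finite: "\<And>s. s > 0 \<Longrightarrow> emeasure m {0..s} < \<infinity>"
  shows "sigma_finite_measure m"
proof
  have space: "space m = {0..}"
    using sets_eq_imp_space_eq[OF sets] by (simp add: space_restrict_space)
  let ?\<C> = "range (\<lambda>n. {0..real (Suc n)})"
  have "\<Union>?\<C> = {0::real..}"
  proof (intro set_eqI iffI)
    fix s :: real assume "s \<in> {0..}"
    moreover obtain n where "s \<le> real n"
      using real_arch_simple by blast
    ultimately show "s \<in> \<Union>?\<C>"
      by (auto intro!: exI[of _ n])
  qed auto
  moreover have "?\<C> \<subseteq> sets m"
    unfolding sets by (subst subset_iff) (auto simp: sets_restrict_space_iff)
  moreover have "\<forall>a\<in>?\<C>. emeasure m a \<noteq> \<infinity>"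
    using finite by (auto simp: less_top[symmetric])
  ultimately show "\<exists>A. countable A \<and> A \<subseteq> sets m \<and> \<Union> A = space m \<and> (\<forall>a\<in>A. emeasure m a \<noteq> \<infinity>)"
    unfolding space by (intro exI[of _ ?\<C>]) simp
qed

lemma space_germ_intensity:
  assumes "sets m = sets (restrict_space borel {0::real..})"
  shows "space (germ_intensity m) = germs"
  using sets_eq_imp_space_eq[OF assms]
  by (simp add: germ_intensity_def space_pair_measure germs_def space_restrict_space)

context crystal_growth
begin

text \<open>For each birth time the section of the cone at \<open>x\<close> is a translate of the
  section at the origin. Lebesgue measure does not see the translation, and integrating over birth
  times gives the claim.\<close>

lemma emeasure_reaching_germs:
  assumes sets: "sets m = sets (restrict_space borel {0::real..})"
    and finite: "\<And>s. s > 0 \<Longrightarrow> emeasure m {0..s} < \<infinity>"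
  shows "emeasure (germ_intensity m) (reaching_germs \<A> x t) = emeasure (germ_intensity m) (causal_cone \<A> t)"
proof -
  interpret m: sigma_finite_measure m
    using assms by (rule sigma_finite_locally_finite)
  interpret pair_sigma_finite "lborel :: (real ^ 'd) measure" m
    by unfold_locales
  have *: "emeasure lborel ((\<lambda>y. (y, s)) -` reaching_germs \<A> x t)
      = emeasure lborel ((\<lambda>y. (y, s)) -` reaching_germs \<A> 0 t)" (is "emeasure lborel ?X = emeasure lborel ?Y") for s
  proof -
    have "?X \<in> sets borel"
      using sets_Pair2[OF sets_reaching_germs[OF sets, of x t, unfolded germ_intensity_def], of s] by simp
    moreover have "(+) x -` ?X = ?Y"
      using translation[of "(_, s)" x] translation[of "(_, s)" 0]
      by (auto simp: reaching_germs_def germs_def)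
    ultimately show ?thesis
      by (subst lborel_distr_plus[of x, symmetric]) (simp add: emeasure_distr)
  qed
  show ?thesis
    unfolding causal_cone_eq germ_intensity_def
    using sets_reaching_germs[OF sets, unfolded germ_intensity_def]
    by (simp add: emeasure_pair_measure_alt2 *)
qed

lemma emeasure_reaching_germs_finite:
  assumes sets: "sets m = sets (restrict_space borel {0::real..})"
    and finite: "\<And>s. s > 0 \<Longrightarrow> emeasure m {0..s} < \<infinity>"
    and t: "0 < t"
  shows "emeasure (germ_intensity m) (reaching_germs \<A> x t) < \<infinity>"
proof -
  interpret m: sigma_finite_measure m
    using assms(1,2) by (rule sigma_finite_locally_finite)
  have "{0..t} \<in> sets m"
    unfolding sets by (auto simp: sets_restrict_space_iff)
  then have "emeasure (germ_intensity m) (cball x (M * t) \<times> {0..t}) = emeasure lborel (cball x (M * t)) * emeasure m {0..t}"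
    unfolding germ_intensity_def by (intro m.emeasure_pair_measure_Times) auto
  also have "\<dots> < \<infinity>"
    using finite[OF t] emeasure_lborel_cball_finite[of x "M * t"] by (simp add: ennreal_mult_less_top)
  finally have "emeasure (germ_intensity m) (cball x (M * t) \<times> {0..t}) < \<infinity>" .
  moreover have "cball x (M * t) \<times> {0..t} \<in> sets (germ_intensity m)"
    using \<open>{0..t} \<in> sets m\<close> unfolding germ_intensity_def by auto
  ultimately show ?thesis
    using emeasure_mono[OF reaching_germs_subset] le_less_trans by blast
qed

end

section \<open>Decoupling and void events\<close>

text \<open>The coupling inequality: the preimages of \<open>B\<close> under the two maps differ
  only inside \<open>E\<close>.\<close>

lemma abs_measure_distr_diff_le:
  assumes "prob_space Q" and f: "f \<in> measurable Q L" and g: "g \<in> measurable Q L"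
    and E: "E \<in> sets Q" and eq: "\<And>\<omega>. \<omega> \<in> space Q \<Longrightarrow> \<omega> \<notin> E \<Longrightarrow> f \<omega> = g \<omega>"
    and B: "B \<in> sets L"
  shows "\<bar>measure (distr Q L f) B - measure (distr Q L g) B\<bar> \<le> measure Q E"
proof -
  interpret prob_space Q by fact
  have le: "prob (u -` B \<inter> space Q) \<le> prob (v -` B \<inter> space Q) + prob E"
    if u: "u \<in> measurable Q L" and v: "v \<in> measurable Q L"
      and uv: "\<And>\<omega>. \<omega> \<in> space Q \<Longrightarrow> \<omega> \<notin> E \<Longrightarrow> u \<omega> = v \<omega>" for u v
  proof -
    have "u -` B \<inter> space Q \<subseteq> (v -` B \<inter> space Q) \<union> E"
      using uv by auto
    then have "prob (u -` B \<inter> space Q) \<le> prob ((v -` B \<inter> space Q) \<union> E)"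
      using measurable_sets[OF v B] E by (intro finite_measure_mono) auto
    also have "\<dots> \<le> prob (v -` B \<inter> space Q) + prob E"
      using measurable_sets[OF v B] E by (intro measure_Un_le) auto
    finally show ?thesis .
  qed
  show ?thesis
    using le[OF f g eq] le[OF g f eq[symmetric]] f g B by (simp add: measure_distr)
qed

text \<open>Replacing \<open>Z1, Z2\<close> by \<open>W1, W2\<close> in the joint law costs
  \<open>prob E\<close>. The joint law of the independent \<open>W1, W2\<close> is a product, and
  comparing it with the product of the laws of \<open>Z1, Z2\<close> on two copies of
  \<open>P\<close> costs \<open>2 * prob E\<close>, since either copy may fall into
  \<open>E\<close>. The normalisation of the norm doubles the total of three.\<close>

lemma variation_norm_diff_decoupling:
  assumes "prob_space P"
    and Z: "Z1 \<in> measurable P L1" "Z2 \<in> measurable P L2"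
    and ind: "prob_space.indep_var P L1 W1 L2 W2"
    and E: "E \<in> sets P"
    and eq: "\<And>\<omega>. \<omega> \<in> space P \<Longrightarrow> \<omega> \<notin> E \<Longrightarrow> Z1 \<omega> = W1 \<omega>"
      "\<And>\<omega>. \<omega> \<in> space P \<Longrightarrow> \<omega> \<notin> E \<Longrightarrow> Z2 \<omega> = W2 \<omega>"
  shows "variation_norm_diff (distr P (L1 \<Otimes>\<^sub>M L2) (\<lambda>\<omega>. (Z1 \<omega>, Z2 \<omega>))) (distr P L1 Z1 \<Otimes>\<^sub>M distr P L2 Z2)
    \<le> ennreal (6 * measure P E)"
proof -
  interpret prob_space P by fact
  interpret PP: pair_prob_space P P ..
  have W: "W1 \<in> measurable P L1" "W2 \<in> measurable P L2"
    and law: "distr P L1 W1 \<Otimes>\<^sub>M distr P L2 W2 = distr P (L1 \<Otimes>\<^sub>M L2) (\<lambda>\<omega>. (W1 \<omega>, W2 \<omega>))"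
    using ind by (auto simp: indep_var_distribution_eq)
  let ?L = "L1 \<Otimes>\<^sub>M L2"
  let ?\<mu> = "distr P ?L (\<lambda>\<omega>. (Z1 \<omega>, Z2 \<omega>))"
  let ?\<rho> = "distr P ?L (\<lambda>\<omega>. (W1 \<omega>, W2 \<omega>))"
  let ?\<nu> = "distr P L1 Z1 \<Otimes>\<^sub>M distr P L2 Z2"
  have pairs: "(\<lambda>\<omega>. (Z1 \<omega>, Z2 \<omega>)) \<in> measurable P ?L" "(\<lambda>\<omega>. (W1 \<omega>, W2 \<omega>)) \<in> measurable P ?L"
    using Z W by auto
  have prods: "(\<lambda>(x, y). (Z1 x, Z2 y)) \<in> measurable (P \<Otimes>\<^sub>M P) ?L"
     "(\<lambda>(x, y). (W1 x, W2 y)) \<in> measurable (P \<Otimes>\<^sub>M P) ?L"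
    using Z W by auto
  have sf: "sigma_finite_measure (distr P L2 Z2)" "sigma_finite_measure (distr P L2 W2)"
    using prob_space_distr[OF Z(2)] prob_space_distr[OF W(2)] by (simp_all add: prob_space_imp_sigma_finite)
  have \<nu>: "?\<nu> = distr (P \<Otimes>\<^sub>M P) ?L (\<lambda>(x, y). (Z1 x, Z2 y))"
    by (rule pair_measure_distr[OF Z sf(1)])
  have \<rho>: "?\<rho> = distr (P \<Otimes>\<^sub>M P) ?L (\<lambda>(x, y). (W1 x, W2 y))"
    unfolding law[symmetric] by (rule pair_measure_distr[OF W sf(2)])
  let ?E = "(E \<times> space P) \<union> (space P \<times> E)"
  have "PP.prob (E \<times> space P) = prob E" "PP.prob (space P \<times> E) = prob E"
    using E by (simp_all add: measure_def emeasure_pair_measure_Times emeasure_space_1)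
  then have EE: "?E \<in> sets (P \<Otimes>\<^sub>M P)" "PP.prob ?E \<le> 2 * prob E"
    using measure_Un_le[of "E \<times> space P" "P \<Otimes>\<^sub>M P" "space P \<times> E"] E by auto
  have diff: "\<bar>measure ?\<mu> B - measure ?\<nu> B\<bar> \<le> 3 * prob E" if B: "B \<in> sets ?L" for B
  proof -
    have "\<bar>measure ?\<mu> B - measure ?\<rho> B\<bar> \<le> prob E"
      using pairs E eq B by (intro abs_measure_distr_diff_le prob_space_axioms) auto
    moreover have "\<bar>measure ?\<nu> B - measure ?\<rho> B\<bar> \<le> PP.prob ?E"
      unfolding \<nu> \<rho> using prods EE eq B
      by (intro abs_measure_distr_diff_le PP.prob_space_axioms) (auto simp: space_pair_measure)
    ultimately show ?thesis
      using EE(2) by linarith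
  qed
  have "prob_space ?\<mu>" "prob_space ?\<nu>"
    unfolding \<nu> using pairs(1) prods(1) by (auto intro: prob_space_distr PP.prob_space_distr)
  then have "variation_norm_diff ?\<mu> ?\<nu> = (SUP B\<in>sets ?\<mu>. ennreal (2 * \<bar>measure ?\<mu> B - measure ?\<nu> B\<bar>))"
    by (intro variation_norm_diff_prob_space) (simp_all cong: sets_pair_measure_cong)
  also have "\<dots> \<le> ennreal (6 * prob E)"
    using diff by (intro SUP_least ennreal_leI) force
  finally show ?thesis .
qed

section \<open>Measurability and independence through generated sigma-algebras\<close>

lemma measurable_coarser_sigma:
  assumes X: "X \<in> measurable (sigma (space M) \<G>) S" and \<G>: "\<G> \<subseteq> sets M"
  shows "X \<in> measurable M S"
proof (rule measurableI)
  have Pow: "\<G> \<subseteq> Pow (space M)"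
    using \<G> sets.space_closed by blast
  show "X \<omega> \<in> space S" if "\<omega> \<in> space M" for \<omega>
    using measurable_space[OF X] that Pow by (simp add: space_measure_of_conv)
  show "X -` B \<inter> space M \<in> sets M" if "B \<in> sets S" for B
    using measurable_sets[OF X that] Pow sets.sigma_sets_subset[OF \<G>] by auto
qed

text \<open>Independence extends from intersection-stable generators to the sigma-algebras they
  generate, and these contain all events described by \<open>X\<close> and by
  \<open>Y\<close>.\<close>

lemma (in prob_space) indep_var_sigma:
  assumes G: "Int_stable \<G>1" "Int_stable \<G>2" and ind: "indep_set \<G>1 \<G>2"
    and X: "X \<in> measurable (sigma (space M) \<G>1) S" and Y: "Y \<in> measurable (sigma (space M) \<G>2) T"
  shows "indep_var S X T Y"
proof -
  have ev: "\<G>1 \<subseteq> events" "\<G>2 \<subseteq> events"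
    using ind by (auto dest: indep_setD_ev1 indep_setD_ev2)
  then have Pow: "\<G>1 \<subseteq> Pow (space M)" "\<G>2 \<subseteq> Pow (space M)"
    using sets.space_closed by blast+
  have gen: "{X -` B \<inter> space M |B. B \<in> sets S} \<subseteq> sigma_sets (space M) \<G>1"
    "{Y -` B \<inter> space M |B. B \<in> sets T} \<subseteq> sigma_sets (space M) \<G>2"
    using measurable_sets[OF X] measurable_sets[OF Y] Pow by auto
  have sub: "sigma_sets (space M) \<G>1 \<subseteq> events" "sigma_sets (space M) \<G>2 \<subseteq> events"
    using ev by (auto intro!: sets.sigma_sets_subset)
  have ind': "indep_set (sigma_sets (space M) \<G>1) (sigma_sets (space M) \<G>2)"
    using ind G by (rule indep_set_sigma_sets)
  have rv: "random_variable S X" "random_variable T Y"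
    using X Y ev by (auto intro: measurable_coarser_sigma)
  show ?thesis
    unfolding indep_var_eq
  proof (intro conjI rv indep_setI)
    let ?GX = "sigma_sets (space M) {X -` B \<inter> space M |B. B \<in> sets S}"
    let ?GY = "sigma_sets (space M) {Y -` B \<inter> space M |B. B \<in> sets T}"
    have *: "?GX \<subseteq> sigma_sets (space M) \<G>1" "?GY \<subseteq> sigma_sets (space M) \<G>2"
      by (rule sigma_sets_mono, rule gen)+
    then show "?GX \<subseteq> events" "?GY \<subseteq> events"
      using sub by blast+
    show "prob (a \<inter> b) = prob a * prob b" if "a \<in> ?GX" "b \<in> ?GY" for a b
      using indep_setD[OF ind'] that * by blast
  qed
qed

section \<open>Void events of a Poisson process\<close>

definition void_event :: "'w measure \<Rightarrow> ('w \<Rightarrow> 'a set) \<Rightarrow> 'a set \<Rightarrow> 'w set" where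
  "void_event P N B = {\<omega>\<in>space P. N \<omega> \<inter> B = {}}"

lemma void_event_Int: "void_event P N B \<inter> void_event P N B' = void_event P N (B \<union> B')"
  by (auto simp: void_event_def)

lemma void_event_eq_count: "void_event P N B = point_count N B -` {0} \<inter> space P"
  by (auto simp: void_event_def point_count_def emeasure_count_space_eq_0)

lemma poisson_process_measure_void:
  assumes "poisson_process P \<Lambda> N" "B \<in> sets \<Lambda>" "emeasure \<Lambda> B < \<infinity>"
  shows "measure P (void_event P N B) = exp (- measure \<Lambda> B)"
proof -
  have "void_event P N B = {\<omega>\<in>space P. point_count N B \<omega> = of_nat 0}"
    by (auto simp: void_event_eq_count)
  moreover have "\<forall>n::nat. measure P {\<omega>\<in>space P. point_count N B \<omega> = of_nat n}
      = exp (- measure \<Lambda> B) * measure \<Lambda> B ^ n / fact n"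
    using assms unfolding poisson_process_def by blast
  from spec[OF this, of 0] have "measure P {\<omega>\<in>space P. point_count N B \<omega> = of_nat 0} = exp (- measure \<Lambda> B)"
    by simp
  ultimately show ?thesis
    by simp
qed

lemma poisson_process_sets_void:
  assumes "poisson_process P \<Lambda> N" "B \<in> sets \<Lambda>"
  shows "void_event P N B \<in> sets P"
proof -
  have "point_count N B \<in> borel_measurable P"
    using assms unfolding poisson_process_def by blast
  from measurable_sets[OF this, of "{0}"] show ?thesis
    by (simp add: void_event_eq_count)
qed

text \<open>Avoidance events suffice, and no other counts are recorded: the family is intersection
  stable and already makes the field built from the germs in \<open>S\<close> measurable.\<close>

definition void_events :: "'w measure \<Rightarrow> 'a measure \<Rightarrow> ('w \<Rightarrow> 'a set) \<Rightarrow> 'a set \<Rightarrow> 'w set set" where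
  "void_events P \<Lambda> N S = void_event P N ` {B\<in>sets \<Lambda>. B \<subseteq> S}"

lemma Int_stable_void_events: "Int_stable (void_events P \<Lambda> N S)"
  by (auto simp: Int_stable_def void_events_def void_event_Int)

lemma poisson_process_indep_void:
  assumes P: "poisson_process P \<Lambda> N" and disj: "S1 \<inter> S2 = {}"
  shows "prob_space.indep_set P (void_events P \<Lambda> N S1) (void_events P \<Lambda> N S2)"
proof -
  interpret prob_space P
    using P unfolding poisson_process_def by blast
  have "prob (void_event P N B1 \<inter> void_event P N B2) = prob (void_event P N B1) * prob (void_event P N B2)"
    if B: "B1 \<in> sets \<Lambda>" "B1 \<subseteq> S1" "B2 \<in> sets \<Lambda>" "B2 \<subseteq> S2" for B1 B2
  \<comment> \<open>The counts are a family indexed by the sets themselves, so the product formula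
    for two factors requires distinct indices. Equal disjoint sets are empty and are treated by
    hand.\<close>
  proof (cases "B1 = B2")
    case True
    then have "B1 = {}" "B2 = {}"
      using B disj by auto
    then show ?thesis
      by (simp add: void_event_def prob_space)
  next
    case False
    have "finite {B1, B2}" "{B1, B2} \<subseteq> sets \<Lambda>" "disjoint {B1, B2}"
      using B disj by (auto simp: disjoint_def)
    then have "indep_vars (\<lambda>_. borel) (point_count N) {B1, B2}"
      using P unfolding poisson_process_def by blast
    from indep_varsD[OF this, of "{B1, B2}" "\<lambda>_. {0}"] show ?thesis
      using False by (simp add: void_event_eq_count)
  qed
  then show ?thesis
    using poisson_process_sets_void[OF P] by (intro indep_setI) (auto simp: void_events_def)
qed

section \<open>Laws of the field\<close>

lemma measurable_restrict_continuous_space: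
  fixes T T' :: "'a::topological_space set"
  assumes "T \<subseteq> T'"
  shows "(\<lambda>f. restrict f T) \<in> measurable (continuous_space T') (continuous_space T)"
  unfolding continuous_space_def
proof (rule measurable_restrict_space2)
  show "(\<lambda>f. restrict f T) \<in> space (restrict_space (\<Pi>\<^sub>M x\<in>T'. borel) {f. continuous_on T' f}) \<rightarrow> {f. continuous_on T f}"
    using assms continuous_on_subset by (auto simp: space_restrict_space cong: continuous_on_cong)
  show "(\<lambda>f. restrict f T) \<in> restrict_space (\<Pi>\<^sub>M x\<in>T'. borel) {f. continuous_on T' f} \<rightarrow>\<^sub>M (\<Pi>\<^sub>M x\<in>T. borel)"
    using assms by (intro measurable_restrict_space1 measurable_restrict_subset)
qed

locale crystallization = crystal_growth \<A> M A
  for \<A> :: "'d::finite germ \<Rightarrow> real ^ 'd \<Rightarrow> real" and M A :: real +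
  fixes m :: "real measure" and P :: "'w measure" and N :: "'w \<Rightarrow> 'd germ set"
  assumes m_sets: "sets m = sets (restrict_space borel {0..})"
    and m_locally_finite: "\<And>s. s > 0 \<Longrightarrow> emeasure m {0..s} < \<infinity>"
    and poisson: "poisson_process P (germ_intensity m) N"
begin

sublocale prob_space P
  using poisson unfolding poisson_process_def by blast

lemma points: "\<forall>\<omega>\<in>space P. N \<omega> \<subseteq> space (germ_intensity m) \<and> (\<forall>B. bounded B \<longrightarrow> finite (N \<omega> \<inter> B))"
  by (rule poisson[unfolded poisson_process_def, THEN conjunct2, THEN conjunct1])

lemma space_intensity: "space (germ_intensity m :: 'd germ measure) = germs"
  by (rule space_germ_intensity[OF m_sets])

lemma germs_subset: "\<omega> \<in> space P \<Longrightarrow> N \<omega> \<subseteq> germs"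
  using bspec[OF points, of \<omega>] space_intensity by simp

lemma locally_finite: "\<omega> \<in> space P \<Longrightarrow> bounded B \<Longrightarrow> finite (N \<omega> \<inter> B)"
  using bspec[OF points, of \<omega>] by simp

text \<open>Measurability is with respect to void events inside \<open>S\<close> only; this is how
  independence of disjoint regions of germs passes to the fields.\<close>

lemma measurable_partial_field:
  assumes S: "S \<in> sets (germ_intensity m)"
  shows "(\<lambda>\<omega>. restrict (crystal_field \<A> (\<lambda>\<omega>. N \<omega> \<inter> S) \<omega>) T)
    \<in> measurable (sigma (space P) (void_events P (germ_intensity m) N S)) (continuous_space T)"
    (is "_ \<in> measurable ?\<Sigma> _")
proof -
  let ?X = "crystal_field \<A> (\<lambda>\<omega>. N \<omega> \<inter> S)"
  have sub: "N \<omega> \<inter> S \<subseteq> germs" and fin: "\<And>B. bounded B \<Longrightarrow> finite (N \<omega> \<inter> S \<inter> B)"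
    if "\<omega> \<in> space P" for \<omega>
    using germs_subset[OF that] locally_finite[OF that]
    by (auto intro: finite_subset[of "N \<omega> \<inter> S \<inter> _" "N \<omega> \<inter> _"])
  have space: "space ?\<Sigma> = space P"
    by (simp add: space_measure_of_conv)
  have void: "void_event P N B \<in> sets ?\<Sigma>" if "B \<in> sets (germ_intensity m)" "B \<subseteq> S" for B
    using that by (auto simp: void_events_def void_event_def)
  have "(\<lambda>\<omega>. ?X \<omega> x) \<in> borel_measurable ?\<Sigma>" for x
  proof (rule borel_measurableI_le)
    fix u
    let ?B = "S \<inter> reaching_germs \<A> x u"
    \<comment> \<open>When no germ lies in \<open>S\<close>, the field is the constant
      \<open>Inf {}\<close>, and whether it is at most \<open>u\<close> is the same for all such
      outcomes.\<close>
    have "{\<omega> \<in> space P. ?X \<omega> x \<le> u}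
        = (if Inf {} \<le> u then void_event P N S else {}) \<union> (space P - void_event P N ?B)"
    proof (intro set_eqI)
      fix \<omega>
      show "\<omega> \<in> {\<omega> \<in> space P. ?X \<omega> x \<le> u} \<longleftrightarrow>
        \<omega> \<in> (if Inf {} \<le> u then void_event P N S else {}) \<union> (space P - void_event P N ?B)"
      proof (cases "\<omega> \<in> space P \<and> N \<omega> \<inter> S \<noteq> {}")
        case True
        then have "?X \<omega> x \<le> u \<longleftrightarrow> N \<omega> \<inter> S \<inter> reaching_germs \<A> x u \<noteq> {}"
          using sub fin by (intro crystal_field_le_iff) auto
        with True show ?thesis
          by (auto simp: void_event_def)
      next
        case False
        then show ?thesis
          by (auto simp: void_event_def crystal_field_def)
      qed
    qed
    moreover have "?B \<in> sets (germ_intensity m)"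
      using S sets_reaching_germs[OF m_sets] by auto
    ultimately show "{\<omega> \<in> space ?\<Sigma>. ?X \<omega> x \<le> u} \<in> sets ?\<Sigma>"
      using void[OF S] sets.compl_sets[OF void[of ?B]] unfolding space by auto
  qed
  then have "(\<lambda>\<omega>. restrict (?X \<omega>) T) \<in> measurable ?\<Sigma> (\<Pi>\<^sub>M x\<in>T. borel)"
    by (intro measurable_restrict)
  moreover have "continuous_on T (restrict (?X \<omega>) T)" if "\<omega> \<in> space P" for \<omega>
  proof -
    have "continuous_on UNIV (?X \<omega>)"
      using sub[OF that] fin[OF that] by (rule continuous_on_crystal_field)
    then have "continuous_on T (?X \<omega>)"
      by (rule continuous_on_subset) simp
    then show ?thesis
      by (simp cong: continuous_on_cong)
  qed
  ultimately show ?thesis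
    unfolding continuous_space_def by (intro measurable_restrict_space2) (auto simp: space)
qed

lemma void_events_subset: "void_events P (germ_intensity m) N S \<subseteq> events"
  using poisson_process_sets_void[OF poisson] by (auto simp: void_events_def)

lemma measurable_field:
  "(\<lambda>\<omega>. restrict (crystal_field \<A> N \<omega>) T) \<in> measurable P (continuous_space T)"
proof -
  have "(germs :: 'd germ set) \<in> sets (germ_intensity m)"
    using sets.top[of "germ_intensity m :: 'd germ measure"] space_intensity by simp
  from measurable_coarser_sigma[OF measurable_partial_field[OF this] void_events_subset]
  have "(\<lambda>\<omega>. restrict (crystal_field \<A> (\<lambda>\<omega>. N \<omega> \<inter> germs) \<omega>) T) \<in> measurable P (continuous_space T)" .
  moreover have "N \<omega> \<inter> germs = N \<omega>" if "\<omega> \<in> space P" for \<omega>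
    using germs_subset[OF that] by blast
  ultimately show ?thesis
    by (subst measurable_cong) (auto simp: crystal_field_def)
qed

text \<open>The independent substitutes in the decoupling bound are the fields built from the germs
  in \<open>S\<close> and from the remaining germs.\<close>

lemma absolute_regularity_le:
  assumes S: "S \<in> sets (germ_intensity m)" and E: "E \<in> events"
    and T1: "\<And>\<omega> x. \<omega> \<in> space P \<Longrightarrow> \<omega> \<notin> E \<Longrightarrow> x \<in> T1 \<Longrightarrow>
      crystal_field \<A> (\<lambda>\<omega>. N \<omega> \<inter> S) \<omega> x = crystal_field \<A> N \<omega> x"
    and T2: "\<And>\<omega> x. \<omega> \<in> space P \<Longrightarrow> \<omega> \<notin> E \<Longrightarrow> x \<in> T2 \<Longrightarrow>
      crystal_field \<A> (\<lambda>\<omega>. N \<omega> \<inter> (germs - S)) \<omega> x = crystal_field \<A> N \<omega> x"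
  shows "absolute_regularity P (crystal_field \<A> N) T1 T2 \<le> ennreal (6 * prob E)"
proof -
  let ?X = "crystal_field \<A> N"
  let ?Z = "\<lambda>T \<omega>. restrict (?X \<omega>) T"
  let ?W = "\<lambda>S T \<omega>. restrict (crystal_field \<A> (\<lambda>\<omega>. N \<omega> \<inter> S) \<omega>) T"
  let ?L = "continuous_space T1 \<Otimes>\<^sub>M continuous_space T2"
  have S': "germs - S \<in> sets (germ_intensity m)"
    using sets.compl_sets[OF S] space_intensity by simp
  have "indep_set (void_events P (germ_intensity m) N S) (void_events P (germ_intensity m) N (germs - S))"
    by (intro poisson_process_indep_void poisson) auto
  then have ind: "indep_var (continuous_space T1) (?W S T1) (continuous_space T2) (?W (germs - S) T2)"
    using measurable_partial_field[OF S] measurable_partial_field[OF S']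
    by (rule indep_var_sigma[OF Int_stable_void_events Int_stable_void_events])
  have "variation_norm_diff (distr P ?L (\<lambda>\<omega>. (?Z T1 \<omega>, ?Z T2 \<omega>)))
      (distr P (continuous_space T1) (?Z T1) \<Otimes>\<^sub>M distr P (continuous_space T2) (?Z T2)) \<le> ennreal (6 * prob E)"
    using T1 T2
    by (intro variation_norm_diff_decoupling[OF prob_space_axioms measurable_field measurable_field ind E])
      (auto intro!: restrict_ext)
  moreover have "distr (field_law P ?X (T1 \<union> T2)) ?L (\<lambda>f. (restrict f T1, restrict f T2))
      = distr P ?L (\<lambda>\<omega>. (?Z T1 \<omega>, ?Z T2 \<omega>))"
  proof -
    have "(\<lambda>f. (restrict f T1, restrict f T2)) \<in> measurable (continuous_space (T1 \<union> T2)) ?L"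
      by (intro measurable_Pair measurable_restrict_continuous_space) auto
    then show ?thesis
      unfolding field_law_def using measurable_field
      by (simp add: distr_distr comp_def Int_absorb1)
  qed
  ultimately show ?thesis
    by (simp add: absolute_regularity_def field_law_def)
qed

lemma emeasure_void_reaching:
  assumes "0 < t"
  shows "emeasure P (void_event P N (reaching_germs \<A> x t)) = ennreal (exp (- cone_mass \<A> m t))"
proof -
  have "measure (germ_intensity m) (reaching_germs \<A> x t) = cone_mass \<A> m t"
    using emeasure_reaching_germs[OF m_sets m_locally_finite] by (simp add: cone_mass_def measure_def)
  then show ?thesis
    using poisson_process_measure_void[OF poisson sets_reaching_germs[OF m_sets]
        emeasure_reaching_germs_finite[OF m_sets m_locally_finite assms], of x]
    by (simp add: emeasure_eq_measure)
qed

end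

section \<open>Lattice seeds\<close>

text \<open>The range is half-open because seeds sit at the cell centres \<open>z + 1 / 2\<close>,
  whose coordinates are then symmetric about the origin.\<close>

definition lattice_box :: "nat \<Rightarrow> ('d \<Rightarrow> int) set" where
  "lattice_box k = {z. \<forall>i. z i \<in> {- int k..<int k}}"

lemma lattice_box_eq_PiE: "lattice_box k = (\<Pi>\<^sub>E i\<in>UNIV. {- int k..<int k})"
  by (auto simp: lattice_box_def PiE_UNIV_domain)

lemma finite_lattice_box: "finite (lattice_box k :: ('d::finite \<Rightarrow> int) set)"
  unfolding lattice_box_eq_PiE by (intro finite_PiE) auto

lemma card_lattice_box: "card (lattice_box k :: ('d::finite \<Rightarrow> int) set) = (2 * k) ^ CARD('d)"
proof -
  have "nat (int k + int k) = 2 * k"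
    by simp
  then show ?thesis
    unfolding lattice_box_eq_PiE by (subst card_PiE) simp_all
qed

lemma lattice_box_Suc_mono: "lattice_box k \<subseteq> lattice_box (Suc k)"
proof
  fix z :: "'a \<Rightarrow> int" assume "z \<in> lattice_box k"
  then have "z i \<in> {- int (Suc k)..<int (Suc k)}" for i
    unfolding lattice_box_def by (auto dest!: spec[of _ i])
  then show "z \<in> lattice_box (Suc k)"
    by (simp add: lattice_box_def)
qed

text \<open>A discrete mean value bound, the source of the exponent \<open>d - 1\<close> in the
  shell count. For \<open>n = 0\<close> the truncated exponent is multiplied by zero.\<close>

lemma power_Suc_add_one_le:
  fixes x :: real
  assumes "0 \<le> x"
  shows "(x + 1) ^ n \<le> x ^ n + n * (x + 1) ^ (n - 1)"
proof (induction n)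
  case (Suc n)
  have "(x + 1) ^ Suc n = x * (x + 1) ^ n + (x + 1) ^ n"
    by (simp add: algebra_simps)
  also have "x * (x + 1) ^ n \<le> x * (x ^ n + n * (x + 1) ^ (n - 1))"
    using Suc assms by (intro mult_left_mono)
  also have "x * (n * (x + 1) ^ (n - 1)) \<le> n * (x + 1) ^ n"
    using assms by (cases n) (auto simp: mult_ac intro!: mult_left_mono mult_right_mono)
  then have "x * (x ^ n + n * (x + 1) ^ (n - 1)) + (x + 1) ^ n \<le> x ^ Suc n + Suc n * (x + 1) ^ n"
    by (simp add: algebra_simps)
  finally show ?case
    by simp
qed simp

lemma card_lattice_shell:
  "real (card (lattice_box (Suc k) - lattice_box k :: ('d::finite \<Rightarrow> int) set))
    \<le> real CARD('d) * 2 ^ CARD('d) * real (Suc k) ^ (CARD('d) - 1)"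
proof -
  let ?d = "CARD('d)"
  have "real (card (lattice_box (Suc k) - lattice_box k :: ('d \<Rightarrow> int) set))
      = real ((2 * Suc k) ^ ?d) - real ((2 * k) ^ ?d)"
    by (simp only: card_Diff_subset[OF finite_lattice_box lattice_box_Suc_mono] card_lattice_box)
      (intro of_nat_diff power_mono; simp)
  also have "\<dots> = 2 ^ ?d * ((real k + 1) ^ ?d - real k ^ ?d)"
    by (simp add: power_mult_distrib right_diff_distrib add.commute del: mult_Suc_right)
  also have "\<dots> \<le> 2 ^ ?d * (real ?d * (real k + 1) ^ (?d - 1))"
    using power_Suc_add_one_le[of "real k" ?d] by (intro mult_left_mono) auto
  finally show ?thesis
    by (simp add: mult_ac add_ac)
qed

text \<open>A seed in the shell \<open>lattice_box (Suc k) - lattice_box k\<close> is at sup-norm distance between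
  \<open>l * k\<close> and \<open>l * Suc k\<close> from the origin, and it is given time \<open>C * Suc k\<close> to be reached.\<close>

definition seed :: "real \<Rightarrow> ('d::finite \<Rightarrow> int) \<Rightarrow> real ^ 'd" where
  "seed l z = (\<chi> i. l * (of_int (z i) + 1 / 2))"

text \<open>The seed is the centre of the lattice cell containing \<open>x\<close>, at most half a
  diagonal away. With \<open>Suc k\<close> the first box containing the cell index \<open>z\<close>,
  some coordinate of \<open>z\<close> leaves box \<open>k\<close>, which bounds \<open>l * k\<close>
  by a coordinate of \<open>x\<close>.\<close>

lemma nearby_seed:
  fixes x :: "real ^ 'd::finite"
  assumes l: "0 < l" and x: "\<And>i. \<bar>x $ i\<bar> \<le> \<rho>"
  obtains k z where "z \<in> lattice_box (Suc k) - lattice_box k" "l * k \<le> \<rho>"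
    "dist (seed l z) x \<le> l * sqrt (CARD('d)) / 2"
proof -
  define z where "z i = \<lfloor>x $ i / l\<rfloor>" for i
  have z: "l * z i \<le> x $ i" "x $ i < l * z i + l" for i
  proof -
    have "of_int (z i) \<le> x $ i / l" "x $ i / l < of_int (z i) + 1"
      unfolding z_def by linarith+
    then show "l * z i \<le> x $ i" "x $ i < l * z i + l"
      using l by (simp_all add: field_simps)
  qed
  obtain n where n: "z \<in> lattice_box n"
  proof
    let ?n = "Suc (nat (Max (range (\<lambda>i. \<bar>z i\<bar>))))"
    have "\<bar>z i\<bar> \<le> Max (range (\<lambda>i. \<bar>z i\<bar>))" for i
      by (rule Max_ge) auto
    then have bound: "\<bar>z i\<bar> < int ?n" for i
      by (rule le_less_trans) linarith
    have "z i \<in> {- int ?n..<int ?n}" for i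
      using bound[of i] unfolding atLeastLessThan_iff by linarith
    then show "z \<in> lattice_box ?n"
      unfolding lattice_box_def by blast
  qed
  define k' where "k' = (LEAST n. z \<in> lattice_box n)"
  have k': "z \<in> lattice_box k'"
    unfolding k'_def using n by (rule LeastI)
  \<comment> \<open>The box with index \<open>0\<close> is empty, so the least index is a
    successor.\<close>
  then obtain k where k: "k' = Suc k"
    by (cases k') (auto simp: lattice_box_def)
  then have nk: "z \<notin> lattice_box k"
    using not_less_Least[of k "\<lambda>n. z \<in> lattice_box n"] by (simp add: k'_def)
  then obtain i where "z i < - int k \<or> int k \<le> z i"
    by (auto simp: lattice_box_def not_le not_less)
  then have "l * k \<le> \<bar>x $ i\<bar>"
  proof
    assume "int k \<le> z i"
    then have "l * k \<le> l * z i"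
      using l by (intro mult_left_mono) auto
    then show ?thesis
      using z(1)[of i] by linarith
  next
    \<comment> \<open>On the negative side the upper face of the cell is the relevant one:
      \<open>z i + 1 \<le> - k\<close> for integers, and
      \<open>x $ i < l * (z i + 1)\<close>.\<close>
    assume "z i < - int k"
    then have "l * (z i + 1) \<le> l * (- k)"
      using l by (intro mult_left_mono) auto
    then show ?thesis
      using z(2)[of i] by (simp add: algebra_simps)
  qed
  moreover have "dist (seed l z) x \<le> l * sqrt (CARD('d)) / 2"
  proof -
    have "(seed l z - x) $ i = l * z i + l / 2 - x $ i" for i
      by (simp add: seed_def distrib_left)
    then have "\<bar>(seed l z - x) $ i\<bar> \<le> l / 2" for i
      using z[of i] by (simp only: abs_le_iff) (simp add: field_simps)
    then have "norm (seed l z - x) \<le> L2_set (\<lambda>_. l / 2) (UNIV :: 'd set)"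
      unfolding norm_vec_def by (intro L2_set_mono) (auto simp: real_norm_def)
    also have "\<dots> = l * sqrt (CARD('d)) / 2"
      using l by (simp add: L2_set_constant)
    finally show ?thesis
      by (simp add: dist_norm)
  qed
  ultimately show ?thesis
    using that[of z k] k' k nk x[of i] by auto
qed

definition seeds_reached ::
    "('d::finite germ \<Rightarrow> real ^ 'd \<Rightarrow> real) \<Rightarrow> real \<Rightarrow> real \<Rightarrow> 'd germ set \<Rightarrow> bool" where
  "seeds_reached \<A> l C G \<longleftrightarrow> (\<forall>k. \<forall>z\<in>lattice_box (Suc k) - lattice_box k.
     G \<inter> reaching_germs \<A> (seed l z) (C * real (Suc k)) \<noteq> {})"

text \<open>Shielding is applied at the seed near \<open>x\<close>. The first term bounding
  \<open>\<delta>\<close> from below is the half-diagonal of a cell times \<open>A\<close>; the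
  other two bound the distance covered at speed \<open>M\<close> in the time
  \<open>C * Suc k\<close>, using \<open>l * k \<le> \<rho>\<close>. Since \<open>A\<close> is at
  least \<open>1\<close>, the same bound keeps \<open>g\<close> itself within
  \<open>\<delta>\<close>.\<close>

lemma (in crystal_growth) dominating_germ:
  assumes l: "0 < l" and C: "0 < C" and G: "seeds_reached \<A> l C G"
    and x: "\<And>i. \<bar>x $ i\<bar> \<le> \<rho>"
    and \<delta>: "A * (l * sqrt (CARD('d)) / 2) + M * C + M * C / l * \<rho> < \<delta>"
  obtains g where "g \<in> G" "g \<in> germs" "dist (fst g) x < \<delta>"
    "\<And>h. h \<in> germs \<Longrightarrow> \<delta> \<le> dist (fst h) x \<Longrightarrow> \<A> g x \<le> \<A> h x"
proof -
  obtain k z where kz: "z \<in> lattice_box (Suc k) - lattice_box k" "l * k \<le> \<rho>"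
    "dist (seed l z) x \<le> l * sqrt (CARD('d)) / 2"
    using nearby_seed[OF l x] by metis
  define t where "t = C * real (Suc k)"
  obtain g where "g \<in> G" and g: "g \<in> reaching_germs \<A> (seed l z) t"
    using G kz(1) unfolding seeds_reached_def t_def by blast
  have t: "0 \<le> t"
    using C by (simp add: t_def)
  have "M * C / l * (l * k) \<le> M * C / l * \<rho>"
    using kz(2) M_pos C l by (intro mult_left_mono) auto
  then have Mt: "M * t \<le> M * C + M * C / l * \<rho>"
    using l by (simp add: t_def algebra_simps)
  have "A * dist (seed l z) x \<le> A * (l * sqrt (CARD('d)) / 2)"
    using kz(3) A_pos by (intro mult_left_mono) auto
  then have far: "A * dist (seed l z) x + M * t < \<delta>"
    using \<delta> Mt by linarith
  have "dist (fst g) (seed l z) \<le> M * t"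
    using subsetD[OF reaching_germs_subset g] by (cases g) (simp add: dist_commute)
  moreover have "dist (seed l z) x \<le> A * dist (seed l z) x"
    using mult_right_mono[OF A_ge_1, of "dist (seed l z) x"] by simp
  ultimately have near: "dist (fst g) x < \<delta>"
    using far dist_triangle[of "fst g" x "seed l z"] by linarith
  have "\<A> g x \<le> \<A> h x" if "h \<in> germs" "\<delta> \<le> dist (fst h) x" for h
    using g that far t by (intro shielding[of g h t "seed l z"]) (auto simp: reaching_germs_def)
  then show ?thesis
    using that[OF \<open>g \<in> G\<close> _ near] g by (auto simp: reaching_germs_def)
qed

section \<open>Probability that some seed is not reached in time\<close>

context crystallization
begin

definition seed_failure :: "real \<Rightarrow> real \<Rightarrow> 'w set" where
  "seed_failure l C = (\<Union>k. \<Union>z\<in>lattice_box (Suc k) - lattice_box k.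
     void_event P N (reaching_germs \<A> (seed l z) (C * real (Suc k))))"

lemma sets_seed_failure: "seed_failure l C \<in> events"
  unfolding seed_failure_def
  by (intro sets.countable_UN' sets.finite_UN finite_Diff finite_lattice_box)
    (auto intro: poisson_process_sets_void[OF poisson sets_reaching_germs[OF m_sets]])

lemma seeds_reached_if_not_failure:
  "\<omega> \<in> space P \<Longrightarrow> \<omega> \<notin> seed_failure l C \<Longrightarrow> seeds_reached \<A> l C (N \<omega>)"
  unfolding seeds_reached_def seed_failure_def void_event_def by blast

text \<open>A union bound, first over the finitely many equally likely failures in a shell, then
  over shells. Working in \<open>ennreal\<close> avoids any question of convergence.\<close>

lemma emeasure_seed_failure_le:
  assumes C: "0 < C"
  shows "emeasure P (seed_failure l C) \<le> ennreal (real CARD('d) * 2 ^ CARD('d)) *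
    (\<Sum>k. ennreal (real (Suc k) ^ (CARD('d) - 1) * exp (- cone_mass \<A> m (C * real (Suc k)))))"
proof -
  let ?V = "\<lambda>k z. void_event P N (reaching_germs \<A> (seed l z) (C * real (Suc k)))"
  let ?L = "\<lambda>k. lattice_box (Suc k) - lattice_box k :: ('d \<Rightarrow> int) set"
  let ?F = "\<lambda>k. exp (- cone_mass \<A> m (C * real (Suc k)))"
  let ?c = "real CARD('d) * 2 ^ CARD('d)"
  have V: "?V k z \<in> events" for k z
    by (intro poisson_process_sets_void[OF poisson sets_reaching_germs[OF m_sets]])
  have fin: "finite (?L k)" for k
    by (intro finite_Diff finite_lattice_box)
  have shell: "emeasure P (\<Union>z\<in>?L k. ?V k z) \<le> ennreal ?c * ennreal (real (Suc k) ^ (CARD('d) - 1) * ?F k)" for k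
  proof -
    have "emeasure P (\<Union>z\<in>?L k. ?V k z) \<le> (\<Sum>z\<in>?L k. emeasure P (?V k z))"
      using V fin by (intro emeasure_subadditive_finite) auto
    also have "\<dots> = ennreal (real (card (?L k)) * ?F k)"
      using emeasure_void_reaching C by (simp add: ennreal_mult' ennreal_of_nat_eq_real_of_nat)
    also have "\<dots> \<le> ennreal (?c * real (Suc k) ^ (CARD('d) - 1) * ?F k)"
      by (intro ennreal_leI mult_right_mono card_lattice_shell) auto
    finally show ?thesis
      by (simp add: ennreal_mult'' mult.assoc)
  qed
  have "emeasure P (seed_failure l C) \<le> (\<Sum>k. emeasure P (\<Union>z\<in>?L k. ?V k z))"
    unfolding seed_failure_def using V fin
    by (intro emeasure_subadditive_countably) (auto intro!: sets.finite_UN)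
  also have "\<dots> \<le> (\<Sum>k. ennreal ?c * ennreal (real (Suc k) ^ (CARD('d) - 1) * ?F k))"
    by (intro suminf_le shell) auto
  also have "\<dots> = ennreal ?c * (\<Sum>k. ennreal (real (Suc k) ^ (CARD('d) - 1) * ?F k))"
    by (rule ennreal_suminf_cmult)
  finally show ?thesis .
qed

end

section \<open>Conclusion\<close>

lemma abs_component_diff_le_dist: "\<bar>x $ i - y $ i\<bar> \<le> dist x (y :: real ^ 'd::finite)"
  using component_le_norm_cart[of "x - y" i] by (simp add: dist_norm)

lemma mem_symmetric_cbox:
  fixes x :: "real ^ 'd::finite"
  shows "x \<in> cbox (\<chi> i. - c) (\<chi> i. c) \<longleftrightarrow> (\<forall>i. \<bar>x $ i\<bar> \<le> c)"
  by (auto simp: mem_box_cart abs_le_iff minus_le_iff)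

theorem theorem4:
  fixes \<A> :: "'d::finite germ \<Rightarrow> real ^ 'd \<Rightarrow> real"
    and M A H a b r R C :: real
    and m :: "real measure"
    and P :: "'w measure"
    and N :: "'w \<Rightarrow> 'd germ set"
    and T1 T2 :: "(real ^ 'd) set"
  assumes dim: "CARD('d) \<ge> 2"
    and growth: "crystal_growth \<A> M A"
    and m_sets: "sets m = sets (restrict_space borel {0..})"
    and m_nonzero: "emeasure m {0..} \<noteq> 0"
    and m_locally_finite: "\<And>s. s > 0 \<Longrightarrow> emeasure m {0..s} < \<infinity>"
    and poisson: "poisson_process P (germ_intensity m) N"
    and H: "H = 2 * (A + M)"
    and a: "a > 0"
    and b: "b > 0" "b \<ge> 2 * (H - 1) * a"
    and T1: "T1 = cbox (\<chi> i. - a) (\<chi> i. a)"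
    and T2: "T2 = - cbox (\<chi> i. - b) (\<chi> i. b)"
    and r: "r = (b - 2 * a) * sqrt (real CARD('d)) / 4"
    and R: "R = r / H"
    and C: "C = 2 * R / (real CARD('d) * H)"
  shows "absolute_regularity P (crystal_field \<A> N) T1 T2
    \<le> ennreal (8 * (1 + real CARD('d) * 2 ^ CARD('d))) *
       (\<Sum>k. ennreal (real (Suc k) ^ (CARD('d) - 1) * exp (- cone_mass \<A> m (C * real (Suc k)))))"
proof -
  interpret crystal_growth \<A> M A
    by (rule growth)
  interpret crystallization \<A> M A m P N
    by unfold_locales (use m_sets m_locally_finite poisson in auto)
  define D where "D = b - 2 * a"
  define c where "c = (a + b) / 2"
  define q where "q = sqrt (real CARD('d))"
  \<comment> \<open>The mesh is chosen so that \<open>A\<close> times half the diagonal of a cell is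
    exactly \<open>D / 4\<close>.\<close>
  define l where "l = D / (2 * A * q)"
  have q: "1 \<le> q" "q\<^sup>2 = real CARD('d)"
    using dim by (auto simp: q_def)
  have H0: "0 < H" "2 * (1 + M) \<le> H"
    using H A_ge_1 M_pos by auto
  have "2 * (1 + M) * a \<le> H * a"
    using H0(2) a by (intro mult_right_mono) auto
  \<comment> \<open>Here \<open>2 * (H - 1) * a\<close> is at least
    \<open>2 * a + 4 * M * a\<close>.\<close>
  then have D: "0 < D"
    using b(2) mult_pos_pos[OF M_pos a] by (simp add: D_def algebra_simps)
  have l: "0 < l"
    using D A_pos q by (simp add: l_def)
  have C_eq: "C = D / (2 * q * H\<^sup>2)"
    using q H0 unfolding C R r D_def[symmetric] q_def[symmetric] q(2)[symmetric]
    by (simp add: field_simps power2_eq_square)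
  then have C0: "0 < C"
    using D q H0 by simp
  \<comment> \<open>The inequality of arithmetic and geometric means for \<open>A\<close> and
    \<open>M\<close>.\<close>
  have H2: "16 * (A * M) \<le> H\<^sup>2"
    using zero_le_power2[of "A - M"] by (simp add: H power2_eq_square algebra_simps)
  \<comment> \<open>Both \<open>D\<close> and \<open>q\<close> cancel, leaving
    \<open>A * M / H\<^sup>2\<close>.\<close>
  have speed: "M * C / l \<le> 1 / 16"
    using H2 D q H0 A_pos by (simp add: C_eq l_def field_simps)
  have "16 * M \<le> H\<^sup>2"
    using H2 mult_right_mono[OF A_ge_1 less_imp_le[OF M_pos]] by linarith
  moreover have "H\<^sup>2 \<le> q * H\<^sup>2"
    using q(1) by (simp add: mult_le_cancel_right1)
  ultimately have "16 * M \<le> q * H\<^sup>2"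
    by linarith
  moreover have "0 < q * H\<^sup>2"
    using q(1) H0(1) by simp
  ultimately have "M / (q * H\<^sup>2) \<le> 1 / 16"
    by (simp add: pos_divide_le_eq)
  then have start: "M * C \<le> D / 32"
    using mult_left_mono[of "M / (q * H\<^sup>2)" "1 / 16" "D / 2"] D by (simp add: C_eq)
  have radius: "A * (l * sqrt (real CARD('d)) / 2) = D / 4"
    using A_pos q by (simp add: l_def q_def[symmetric])
  have margin: "A * (l * sqrt (real CARD('d)) / 2) + M * C + M * C / l * \<rho> < \<delta>"
    if "0 \<le> \<rho>" "D / 4 + D / 32 + \<rho> / 16 < \<delta>" for \<rho> \<delta>
    using mult_right_mono[OF speed that(1)] start that(2) radius by simp

  define S :: "'d germ set" where "S = cbox (\<chi> i. - c) (\<chi> i. c) \<times> {0..}"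
  have mem_S: "g \<in> S \<longleftrightarrow> (\<forall>i. \<bar>fst g $ i\<bar> \<le> c)" if "g \<in> germs" for g
    using that by (cases g) (auto simp: S_def germs_def mem_symmetric_cbox)
  have "{0..} \<in> sets m"
    unfolding m_sets by (auto simp: sets_restrict_space_iff)
  then have S: "S \<in> sets (germ_intensity m)"
    unfolding S_def germ_intensity_def by auto
  let ?E = "seed_failure l C"
  have "absolute_regularity P (crystal_field \<A> N) T1 T2 \<le> ennreal (6 * prob ?E)"
  proof (rule absolute_regularity_le[OF S sets_seed_failure])
    fix \<omega> x assume \<omega>: "\<omega> \<in> space P" "\<omega> \<notin> ?E" and "x \<in> T1"
    then have x: "\<bar>x $ i\<bar> \<le> a" for i
      by (simp add: T1 mem_symmetric_cbox)
    \<comment> \<open>The right-hand side equals \<open>D / 2 + a / 2\<close>.\<close>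
    have "D / 4 + D / 32 + a / 16 < c - a"
      using D a by (simp add: c_def D_def field_simps)
    then obtain g where g: "g \<in> N \<omega>" "g \<in> germs" "dist (fst g) x < c - a"
      and best: "\<And>h. h \<in> germs \<Longrightarrow> c - a \<le> dist (fst h) x \<Longrightarrow> \<A> g x \<le> \<A> h x"
      using dominating_germ[OF l C0 seeds_reached_if_not_failure[OF \<omega>] x margin] a
      by (metis less_imp_le)
    have "\<bar>fst g $ i\<bar> \<le> c" for i
      using abs_component_diff_le_dist[of "fst g" i x] g(3) x[of i] by linarith
    then have "g \<in> S"
      using mem_S[OF g(2)] by simp
    moreover have "c - a \<le> dist (fst h) x" if h: "h \<in> N \<omega>" "h \<notin> S" for h
    proof -
      obtain i where "c < \<bar>fst h $ i\<bar>"
        using mem_S[of h] h germs_subset[OF \<omega>(1)] by (auto simp: not_le)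
      then show ?thesis
        using abs_component_diff_le_dist[of "fst h" i x] x[of i] by linarith
    qed
    ultimately show "crystal_field \<A> (\<lambda>\<omega>. N \<omega> \<inter> S) \<omega> x = crystal_field \<A> N \<omega> x"
      using g(1) best germs_subset[OF \<omega>(1)] by (intro crystal_field_restrict_eq) blast+
  next
    fix \<omega> x assume \<omega>: "\<omega> \<in> space P" "\<omega> \<notin> ?E" and "x \<in> T2"
    then obtain i where i: "b < \<bar>x $ i\<bar>"
      by (auto simp: T2 mem_symmetric_cbox not_le)
    \<comment> \<open>A coordinate of largest modulus realises the sup-norm of \<open>x\<close>;
      along it every germ in \<open>S\<close> is at distance at least \<open>?\<rho> - c\<close>.
      The required radius grows only like \<open>?\<rho> / 16\<close>, so unboundedness of
      \<open>T2\<close> does no harm.\<close>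
    obtain j where j: "\<And>i. \<bar>x $ i\<bar> \<le> \<bar>x $ j\<bar>"
      using Max_in[of "range (\<lambda>i. \<bar>x $ i\<bar>)"] Max_ge[of "range (\<lambda>i. \<bar>x $ i\<bar>)"] by fastforce
    let ?\<rho> = "\<bar>x $ j\<bar>"
    \<comment> \<open>As \<open>?\<rho>\<close> exceeds \<open>b = D + 2 * a\<close>, the difference
      \<open>15 / 16 * ?\<rho> - c\<close> exceeds \<open>7 / 16 * D + 3 / 8 * a\<close>.\<close>
    have "D / 4 + D / 32 + ?\<rho> / 16 < ?\<rho> - c"
      using D a i j[of i] by (simp add: c_def D_def field_simps)
    then obtain g where g: "g \<in> N \<omega>" "g \<in> germs" "dist (fst g) x < ?\<rho> - c"
      and best: "\<And>h. h \<in> germs \<Longrightarrow> ?\<rho> - c \<le> dist (fst h) x \<Longrightarrow> \<A> g x \<le> \<A> h x"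
      using dominating_germ[OF l C0 seeds_reached_if_not_failure[OF \<omega>] j margin]
      by (metis abs_ge_zero)
    have "c < \<bar>fst g $ j\<bar>"
      using abs_component_diff_le_dist[of "fst g" j x] g(3) by linarith
    then have "g \<in> germs - S"
      using mem_S[OF g(2)] g(2) by (auto simp: not_le)
    moreover have "?\<rho> - c \<le> dist (fst h) x" if h: "h \<in> N \<omega>" "h \<notin> germs - S" for h
    proof -
      have "\<bar>fst h $ j\<bar> \<le> c"
        using mem_S[of h] h germs_subset[OF \<omega>(1)] by auto
      then show ?thesis
        using abs_component_diff_le_dist[of "fst h" j x] by linarith
    qed
    ultimately show "crystal_field \<A> (\<lambda>\<omega>. N \<omega> \<inter> (germs - S)) \<omega> x = crystal_field \<A> N \<omega> x"
      using g(1) best germs_subset[OF \<omega>(1)] by (intro crystal_field_restrict_eq) blast+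
  qed
  also have "\<dots> = ennreal 6 * emeasure P ?E"
    by (simp add: emeasure_eq_measure ennreal_mult')
  also have "\<dots> \<le> ennreal 6 * (ennreal (real CARD('d) * 2 ^ CARD('d)) *
      (\<Sum>k. ennreal (real (Suc k) ^ (CARD('d) - 1) * exp (- cone_mass \<A> m (C * real (Suc k))))))"
    by (intro mult_left_mono emeasure_seed_failure_le C0) auto
  also have "\<dots> = ennreal (6 * (real CARD('d) * 2 ^ CARD('d))) *
      (\<Sum>k. ennreal (real (Suc k) ^ (CARD('d) - 1) * exp (- cone_mass \<A> m (C * real (Suc k)))))"
    by (simp only: ennreal_mult' mult.assoc[symmetric] zero_le_numeral)
  \<comment> \<open>The argument gives the factor \<open>6 * (d * 2 ^ d)\<close> with
    \<open>d = CARD('d)\<close>, which is below the stated one.\<close>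
  also have "\<dots> \<le> ennreal (8 * (1 + real CARD('d) * 2 ^ CARD('d))) *
      (\<Sum>k. ennreal (real (Suc k) ^ (CARD('d) - 1) * exp (- cone_mass \<A> m (C * real (Suc k)))))"
    by (intro mult_right_mono ennreal_leI) auto
  finally show ?thesis .
qed

end
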